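(* Let $(R,\mathfrak m)$ be a Noetherian local ring, $M,X$ finitely generated $R$-modules, $J$ an ideal of $R$, and $N$ a submodule of $X$ such that $N\subseteq\mathfrak mJX$, $X/(N:_XJ)$ has finite length, and $(N:_XJ)=(\mathfrak mN:_X\mathfrak mJ)$. Assume there is an integer $t\ge1$ with $\operatorname{Tor}_t^R(M,X/N)=0$, and let $(F_n,\partial_n)$ be a minimal free resolution of $M$. Then: (1) $\partial_t\otimes_R(JX)=0$, i.e. $I_1(\partial_t)\subseteq\operatorname{ann}_R(JX)$; (2) if $X$ is faithful and $J$ contains a non-zero-divisor, then $\operatorname{pd}_RM<t$; (3) if $\operatorname{Supp}(JX)=\operatorname{Spec}(R)$ and $M$ is locally free on $\operatorname{Ass}(R)$, then $\operatorname{pd}_RM<t$; (4) if $\operatorname{Tor}_t^R(M,X)=0$, then $J\cdot(\Omega^tM\otimes_RX)=0$.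
   Context: Modules are finitely generated. For a submodule $N\subseteq X$ and ideal $I$, $(N:_XI)=\{x\in X: Ix\subseteq N\}$. A minimal free resolution satisfies $\operatorname{Im}\partial_n\subseteq\mathfrak mF_{n-1}$; $\Omega^tM=\operatorname{Im}\partial_t$; $I_1(\partial)$ is the ideal generated by the entries of a matrix of $\partial$. Projective dimension of the zero module is $-\infty$. *)

theory Defs
  imports "HOL-Algebra.Algebra"
begin

definition ring_module :: "('a, 'b) ring_scheme \<Rightarrow> ('a, 'a) module" where
  "ring_module R = \<lparr>carrier = carrier R, monoid.mult = monoid.mult R, monoid.one = monoid.one R,
                    ring.zero = ring.zero R, ring.add = ring.add R, module.smult = monoid.mult R\<rparr>"

definition lin_comb :: "('a, 'm) module \<Rightarrow> (nat \<Rightarrow> 'a) \<Rightarrow> (nat \<Rightarrow> 'm) \<Rightarrow> nat \<Rightarrow> 'm" where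
  "lin_comb M c g n = (\<Oplus>\<^bsub>M\<^esub> j \<in> {..<n}. c j \<odot>\<^bsub>M\<^esub> g j)"

definition tuples :: "'x set \<Rightarrow> nat \<Rightarrow> (nat \<Rightarrow> 'x) set" where
  "tuples S n = {v. \<forall>i<n. v i \<in> S}"

definition finitely_generated :: "('a, 'b) ring_scheme \<Rightarrow> ('a, 'm) module \<Rightarrow> bool" where
  "finitely_generated R M \<longleftrightarrow> (\<exists>n g. g \<in> tuples (carrier M) n \<and>
     (\<forall>x \<in> carrier M. \<exists>c \<in> tuples (carrier R) n. x = lin_comb M c g n))"

definition noeth_local_ring :: "('a, 'b) ring_scheme \<Rightarrow> 'a set \<Rightarrow> bool" where
  "noeth_local_ring R m \<longleftrightarrow> cring R \<and> noetherian_ring R \<and> maximalideal m R \<and>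
     (\<forall>I. maximalideal I R \<longrightarrow> I = m)"

definition ideal_prod_set :: "('a, 'b) ring_scheme \<Rightarrow> 'a set \<Rightarrow> 'a set \<Rightarrow> 'a set" where
  "ideal_prod_set R I J = genideal R {a \<otimes>\<^bsub>R\<^esub> b | a b. a \<in> I \<and> b \<in> J}"

definition ideal_smult :: "('a, 'b) ring_scheme \<Rightarrow> ('a, 'm) module \<Rightarrow> 'a set \<Rightarrow> 'm set \<Rightarrow> 'm set" where
  "ideal_smult R M I S = {lin_comb M c s n | c s n. c \<in> tuples I n \<and> s \<in> tuples S n}"

definition colon_sub :: "('a, 'b) ring_scheme \<Rightarrow> ('a, 'm) module \<Rightarrow> 'm set \<Rightarrow> 'a set \<Rightarrow> 'm set" where
  "colon_sub R XM N K = {x \<in> carrier XM. \<forall>a \<in> K. smult XM a x \<in> N}"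

text \<open>XM/L has finite length: there is a composition series L = L_0 < L_1 < ... < L_n = XM
  of submodules of XM with no submodule strictly between consecutive terms (a composition
  series of XM/L, via the correspondence between submodules of XM/L and submodules of XM
  containing L).\<close>
definition quotient_finite_length :: "('a, 'b) ring_scheme \<Rightarrow> ('a, 'm) module \<Rightarrow> 'm set \<Rightarrow> bool" where
  "quotient_finite_length R XM L \<longleftrightarrow> (\<exists>n ch. ch 0 = L \<and> ch n = carrier XM \<and>
     (\<forall>i\<le>n. submodule (ch i) R XM) \<and>
     (\<forall>i<n. ch i \<subset> ch (Suc i) \<and>
        \<not> (\<exists>K. submodule K R XM \<and> ch i \<subset> K \<and> K \<subset> ch (Suc i))))"

text \<open>F_n = R^(b n); the differential d_n : F_n \<rightarrow> F_(n-1) (n \<ge> 1) is the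
  (b (n-1)) x (b n) matrix  d n i j.  Applying it to a tuple v of elements of a module Y
  computes d_n \<otimes> Y on Y^(b n) = F_n \<otimes> Y.\<close>
definition mat_app :: "('a, 'm) module \<Rightarrow> (nat \<Rightarrow> nat \<Rightarrow> 'a) \<Rightarrow> nat \<Rightarrow> (nat \<Rightarrow> 'm) \<Rightarrow> nat \<Rightarrow> 'm" where
  "mat_app Y A k v i = (\<Oplus>\<^bsub>Y\<^esub> j \<in> {..<k}. A i j \<odot>\<^bsub>Y\<^esub> v j)"

definition free_resolution ::
  "('a, 'b) ring_scheme \<Rightarrow> ('a, 'm) module \<Rightarrow> (nat \<Rightarrow> nat) \<Rightarrow> (nat \<Rightarrow> nat \<Rightarrow> nat \<Rightarrow> 'a) \<Rightarrow> (nat \<Rightarrow> 'm) \<Rightarrow> bool" where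
  "free_resolution R M b d g \<longleftrightarrow>
     (\<forall>n\<ge>1. \<forall>i<b (n - 1). \<forall>j<b n. d n i j \<in> carrier R) \<and>
     g \<in> tuples (carrier M) (b 0) \<and>
     (\<forall>x \<in> carrier M. \<exists>c \<in> tuples (carrier R) (b 0). x = lin_comb M c g (b 0)) \<and>
     (\<forall>c \<in> tuples (carrier R) (b 0).
        lin_comb M c g (b 0) = \<zero>\<^bsub>M\<^esub> \<longleftrightarrow>
        (\<exists>z \<in> tuples (carrier R) (b 1). \<forall>i<b 0. c i = mat_app (ring_module R) (d 1) (b 1) z i)) \<and>
     (\<forall>n\<ge>1. \<forall>c \<in> tuples (carrier R) (b n).
        (\<forall>i<b (n - 1). mat_app (ring_module R) (d n) (b n) c i = \<zero>\<^bsub>R\<^esub>) \<longleftrightarrow>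
        (\<exists>z \<in> tuples (carrier R) (b (Suc n)).
           \<forall>i<b n. c i = mat_app (ring_module R) (d (Suc n)) (b (Suc n)) z i))"

definition minimal_free_resolution ::
  "('a, 'b) ring_scheme \<Rightarrow> 'a set \<Rightarrow> ('a, 'm) module \<Rightarrow> (nat \<Rightarrow> nat) \<Rightarrow> (nat \<Rightarrow> nat \<Rightarrow> nat \<Rightarrow> 'a) \<Rightarrow> (nat \<Rightarrow> 'm) \<Rightarrow> bool" where
  "minimal_free_resolution R m M b d g \<longleftrightarrow> free_resolution R M b d g \<and>
     (\<forall>n\<ge>1. \<forall>i<b (n - 1). \<forall>j<b n. d n i j \<in> m)"

text \<open>pd_R M < t: M has a (finite-rank) free resolution with F_n = 0 for all n \<ge> t.
  (For M = 0 this holds for every t, matching pd 0 = -\<infinity>.)\<close>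
definition proj_dim_less :: "('a, 'b) ring_scheme \<Rightarrow> ('a, 'm) module \<Rightarrow> nat \<Rightarrow> bool" where
  "proj_dim_less R M t \<longleftrightarrow> (\<exists>b d g. free_resolution R M b d g \<and> (\<forall>n\<ge>t. b n = 0))"

text \<open>Tor_t^R(M, XM/N) = 0 (t \<ge> 1), computed from the free resolution (b,d) of M as
  H_t(F \<otimes> XM/N), with F_n \<otimes> XM/N = (XM/N)^(b n) and elements of XM/N represented
  by elements of XM modulo N.  Tor_t(M,XM) is the case N = {0}.\<close>
definition tor_vanishes ::
  "('a, 'm) module \<Rightarrow> 'm set \<Rightarrow> (nat \<Rightarrow> nat) \<Rightarrow> (nat \<Rightarrow> nat \<Rightarrow> nat \<Rightarrow> 'a) \<Rightarrow> nat \<Rightarrow> bool" where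
  "tor_vanishes XM N b d t \<longleftrightarrow>
     (\<forall>y \<in> tuples (carrier XM) (b t).
        (\<forall>i<b (t - 1). mat_app XM (d t) (b t) y i \<in> N) \<longrightarrow>
        (\<exists>z \<in> tuples (carrier XM) (b (Suc t)).
           \<forall>i<b t. y i \<ominus>\<^bsub>XM\<^esub> mat_app XM (d (Suc t)) (b (Suc t)) z i \<in> N))"

definition faithful :: "('a, 'b) ring_scheme \<Rightarrow> ('a, 'm) module \<Rightarrow> bool" where
  "faithful R XM \<longleftrightarrow> (\<forall>a \<in> carrier R. (\<forall>x \<in> carrier XM. a \<odot>\<^bsub>XM\<^esub> x = \<zero>\<^bsub>XM\<^esub>) \<longrightarrow> a = \<zero>\<^bsub>R\<^esub>)"

definition non_zero_divisor :: "('a, 'b) ring_scheme \<Rightarrow> 'a \<Rightarrow> bool" where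
  "non_zero_divisor R a \<longleftrightarrow> a \<in> carrier R \<and> (\<forall>r \<in> carrier R. a \<otimes>\<^bsub>R\<^esub> r = \<zero>\<^bsub>R\<^esub> \<longrightarrow> r = \<zero>\<^bsub>R\<^esub>)"

text \<open>p \<in> Supp(S) for a submodule S: the localization S_p is nonzero, i.e. some y \<in> S
  has y/1 \<noteq> 0 in X_p.\<close>
definition in_support :: "('a, 'b) ring_scheme \<Rightarrow> ('a, 'm) module \<Rightarrow> 'm set \<Rightarrow> 'a set \<Rightarrow> bool" where
  "in_support R XM S p \<longleftrightarrow> (\<exists>y \<in> S. \<forall>s \<in> carrier R - p. s \<odot>\<^bsub>XM\<^esub> y \<noteq> \<zero>\<^bsub>XM\<^esub>)"

definition ass_ring :: "('a, 'b) ring_scheme \<Rightarrow> 'a set set" where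
  "ass_ring R = {p. primeideal p R \<and> (\<exists>r \<in> carrier R. p = {s \<in> carrier R. s \<otimes>\<^bsub>R\<^esub> r = \<zero>\<^bsub>R\<^esub>})}"

text \<open>M_p is a free R_p-module: there are e_0..e_(k-1) in M whose images e_j/1 form a basis
  of M_p (generation and linear independence unfolded, denominators cleared).\<close>
definition locally_free_at :: "('a, 'b) ring_scheme \<Rightarrow> ('a, 'm) module \<Rightarrow> 'a set \<Rightarrow> bool" where
  "locally_free_at R M p \<longleftrightarrow> (\<exists>k e. e \<in> tuples (carrier M) k \<and>
     (\<forall>x \<in> carrier M. \<exists>s \<in> carrier R - p. \<exists>c \<in> tuples (carrier R) k.
        s \<odot>\<^bsub>M\<^esub> x = lin_comb M c e k) \<and>
     (\<forall>c \<in> tuples (carrier R) k.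
        (\<exists>s \<in> carrier R - p. s \<odot>\<^bsub>M\<^esub> lin_comb M c e k = \<zero>\<^bsub>M\<^esub>) \<longrightarrow>
        (\<forall>j<k. \<exists>s \<in> carrier R - p. s \<otimes>\<^bsub>R\<^esub> c j = \<zero>\<^bsub>R\<^esub>)))"

end

theory Submission
  imports Defs
begin

text \<open>Put \<open>L = (N :\<^sub>X J) = (mN :\<^sub>X mJ)\<close>. If the entries of \<open>d\<^sub>t\<close> map a term \<open>C\<close> of a composition
  series of \<open>X/L\<close> into \<open>L\<close>, and \<open>mC' \<subseteq> C\<close> for the next term \<open>C'\<close>, then for \<open>y \<in> mJC'\<close> each vector
  \<open>y e\<^sub>l\<close> is a cycle modulo \<open>N\<close>. As \<open>Tor\<^sub>t(M, X/N) = 0\<close>, it is a boundary plus a vector over \<open>N\<close>,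
  and applying \<open>d\<^sub>t\<close> leaves an element of \<open>mN\<close>; so \<open>d\<^sub>t\<close> maps \<open>C'\<close> into \<open>(mN :\<^sub>X mJ) = L\<close> as well.
  Hence \<open>I\<^sub>1(d\<^sub>t) J X \<subseteq> N\<close>, and the same argument once more gives
  \<open>I\<^sub>1(d\<^sub>t) J X \<subseteq> I\<^sub>1(d\<^sub>t) N \<subseteq> m I\<^sub>1(d\<^sub>t) J X\<close>, which vanishes by Nakayama.

  For (2) and (3) it suffices that \<open>d\<^sub>t = 0\<close>, since minimality then forces \<open>F\<^sub>t = 0\<close>. In (3) every prime
  contains \<open>I\<^sub>1(d\<^sub>t)\<close>; at an associated prime the resolution splits, so \<open>d\<^sub>t = d\<^sub>t h d\<^sub>t\<close> there, and
  Nakayama makes \<open>d\<^sub>t\<close> vanish locally, hence globally.\<close>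

subsection \<open>Tuples and the ring as a module\<close>

lemma tuplesI: "(\<And>i. i < n \<Longrightarrow> v i \<in> S) \<Longrightarrow> v \<in> tuples S n"
  by (simp add: tuples_def)

lemma tuplesD: "v \<in> tuples S n \<Longrightarrow> i < n \<Longrightarrow> v i \<in> S"
  by (simp add: tuples_def)

lemma mat_app_eq: "mat_app Y A k v i = lin_comb Y (A i) v k"
  by (simp add: mat_app_def lin_comb_def)

text \<open>Negation is unfolded down to \<open>m_inv_def\<close> because the additive inverse
  depends only on carrier, addition and zero, which both records share.\<close>

lemma ring_module_simps [simp]:
  "carrier (ring_module R) = carrier R" "\<zero>\<^bsub>ring_module R\<^esub> = \<zero>\<^bsub>R\<^esub>"
  "x \<oplus>\<^bsub>ring_module R\<^esub> y = x \<oplus>\<^bsub>R\<^esub> y" "a \<odot>\<^bsub>ring_module R\<^esub> x = a \<otimes>\<^bsub>R\<^esub> x"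
  "\<ominus>\<^bsub>ring_module R\<^esub> x = \<ominus>\<^bsub>R\<^esub> x" "x \<ominus>\<^bsub>ring_module R\<^esub> y = x \<ominus>\<^bsub>R\<^esub> y"
  by (simp_all add: ring_module_def a_minus_def a_inv_def m_inv_def)

lemma (in cring) module_ring_module: "module R (ring_module R)"
proof (rule moduleI)
  show "abelian_group (ring_module R)"
    by (rule abelian_groupI) (auto simp: a_ac intro: bexI[of _ "\<ominus> x" for x] l_neg)
qed (auto simp: is_cring l_distr r_distr m_assoc)

subsection \<open>Linear combinations\<close>

text \<open>\<open>lin_comb\<close> and the other notions are defined only for module records without further fields.\<close>

locale lmodule = module R M for R :: "('a, 'b) ring_scheme" (structure) and M :: "('a, 'm) module" (structure)
begin

lemma lin_comb_0 [simp]: "lin_comb M c v 0 = \<zero>\<^bsub>M\<^esub>"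
  by (simp add: lin_comb_def)

lemma lin_comb_Suc:
  assumes "c \<in> tuples (carrier R) (Suc n)" "v \<in> tuples (carrier M) (Suc n)"
  shows "lin_comb M c v (Suc n) = c n \<odot>\<^bsub>M\<^esub> v n \<oplus>\<^bsub>M\<^esub> lin_comb M c v n"
  unfolding lin_comb_def lessThan_Suc
  using assms by (subst M.finsum_insert) (auto simp: tuples_def)

lemma lin_comb_closed [intro]:
  assumes "c \<in> tuples (carrier R) n" "v \<in> tuples (carrier M) n"
  shows "lin_comb M c v n \<in> carrier M"
  unfolding lin_comb_def using assms by (intro M.finsum_closed) (auto simp: tuples_def)

lemma lin_comb_cong:
  assumes "c \<in> tuples (carrier R) n" "v \<in> tuples (carrier M) n"
    and "\<And>i. i < n \<Longrightarrow> c i = c' i" "\<And>i. i < n \<Longrightarrow> v i = v' i"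
  shows "lin_comb M c v n = lin_comb M c' v' n"
  unfolding lin_comb_def using assms
  by (intro M.finsum_cong') (auto simp: tuples_def)

lemma tuples_SucD: "v \<in> tuples S (Suc n) \<Longrightarrow> v \<in> tuples S n" "v \<in> tuples S (Suc n) \<Longrightarrow> v n \<in> S"
  by (auto simp: tuples_def)

lemma lin_comb_zero_left:
  "v \<in> tuples (carrier M) n \<Longrightarrow> lin_comb M (\<lambda>i. \<zero>) v n = \<zero>\<^bsub>M\<^esub>"
  by (induction n) (auto simp: lin_comb_Suc tuples_def)

lemma lin_comb_zero_right:
  "c \<in> tuples (carrier R) n \<Longrightarrow> lin_comb M c (\<lambda>i. \<zero>\<^bsub>M\<^esub>) n = \<zero>\<^bsub>M\<^esub>"
  by (induction n) (auto simp: lin_comb_Suc tuples_def)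

lemma lin_comb_add_right:
  assumes "c \<in> tuples (carrier R) n" "v \<in> tuples (carrier M) n" "w \<in> tuples (carrier M) n"
  shows "lin_comb M c (\<lambda>i. v i \<oplus>\<^bsub>M\<^esub> w i) n = lin_comb M c v n \<oplus>\<^bsub>M\<^esub> lin_comb M c w n"
  using assms
proof (induction n)
  case (Suc n)
  note t = Suc.prems[THEN tuples_SucD(1)] Suc.prems[THEN tuples_SucD(2)]
  have "(\<lambda>i. v i \<oplus>\<^bsub>M\<^esub> w i) \<in> tuples (carrier M) (Suc n)"
    using Suc.prems by (auto simp: tuples_def)
  then show ?case
    using t Suc by (simp add: lin_comb_Suc smult_r_distr lin_comb_closed M.add.m_ac)
qed simp

lemma lin_comb_add_left:
  assumes "c \<in> tuples (carrier R) n" "c' \<in> tuples (carrier R) n" "v \<in> tuples (carrier M) n"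
  shows "lin_comb M (\<lambda>i. c i \<oplus> c' i) v n = lin_comb M c v n \<oplus>\<^bsub>M\<^esub> lin_comb M c' v n"
  using assms
proof (induction n)
  case (Suc n)
  note t = Suc.prems[THEN tuples_SucD(1)] Suc.prems[THEN tuples_SucD(2)]
  have "(\<lambda>i. c i \<oplus> c' i) \<in> tuples (carrier R) (Suc n)"
    using Suc.prems by (auto simp: tuples_def)
  then show ?case
    using t Suc by (simp add: lin_comb_Suc smult_l_distr lin_comb_closed M.add.m_ac)
qed simp

lemma lin_comb_smult_right:
  assumes "c \<in> tuples (carrier R) n" "v \<in> tuples (carrier M) n" "a \<in> carrier R"
  shows "lin_comb M c (\<lambda>i. a \<odot>\<^bsub>M\<^esub> v i) n = a \<odot>\<^bsub>M\<^esub> lin_comb M c v n"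
  using assms
proof (induction n)
  case (Suc n)
  note t = Suc.prems(1,2)[THEN tuples_SucD(1)] Suc.prems(1,2)[THEN tuples_SucD(2)]
  have "(\<lambda>i. a \<odot>\<^bsub>M\<^esub> v i) \<in> tuples (carrier M) (Suc n)"
    using Suc.prems by (auto simp: tuples_def)
  moreover have "c n \<odot>\<^bsub>M\<^esub> (a \<odot>\<^bsub>M\<^esub> v n) = a \<odot>\<^bsub>M\<^esub> (c n \<odot>\<^bsub>M\<^esub> v n)"
    using t Suc.prems(3) by (simp flip: smult_assoc1 add: R.m_comm)
  ultimately show ?case
    using t Suc by (simp add: lin_comb_Suc smult_r_distr lin_comb_closed)
qed simp

lemma lin_comb_smult_left:
  assumes "c \<in> tuples (carrier R) n" "v \<in> tuples (carrier M) n" "a \<in> carrier R"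
  shows "lin_comb M (\<lambda>i. a \<otimes> c i) v n = a \<odot>\<^bsub>M\<^esub> lin_comb M c v n"
  using assms
proof (induction n)
  case (Suc n)
  note t = Suc.prems(1,2)[THEN tuples_SucD(1)] Suc.prems(1,2)[THEN tuples_SucD(2)]
  have "(\<lambda>i. a \<otimes> c i) \<in> tuples (carrier R) (Suc n)"
    using Suc.prems by (auto simp: tuples_def)
  then show ?case
    using t Suc by (simp add: lin_comb_Suc smult_r_distr smult_assoc1 lin_comb_closed)
qed simp

lemma lin_comb_minus_left:
  assumes "c \<in> tuples (carrier R) n" "c' \<in> tuples (carrier R) n" "v \<in> tuples (carrier M) n"
  shows "lin_comb M (\<lambda>i. c i \<ominus> c' i) v n = lin_comb M c v n \<ominus>\<^bsub>M\<^esub> lin_comb M c' v n"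
proof -
  have "lin_comb M (\<lambda>i. c i \<ominus> c' i) v n = lin_comb M (\<lambda>i. c i \<oplus> (\<ominus> \<one>) \<otimes> c' i) v n"
    using assms by (intro lin_comb_cong) (auto simp: tuples_def R.minus_eq R.l_minus)
  also have "\<dots> = lin_comb M c v n \<oplus>\<^bsub>M\<^esub> (\<ominus> \<one>) \<odot>\<^bsub>M\<^esub> lin_comb M c' v n"
    using assms by (subst lin_comb_add_left)
      (auto intro!: tuplesI simp: tuplesD lin_comb_smult_left)
  also have "\<dots> = lin_comb M c v n \<ominus>\<^bsub>M\<^esub> lin_comb M c' v n"
    using assms by (simp add: smult_l_minus lin_comb_closed M.minus_eq)
  finally show ?thesis .
qed

lemma lin_comb_minus_right:
  assumes "c \<in> tuples (carrier R) n" "v \<in> tuples (carrier M) n" "w \<in> tuples (carrier M) n"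
  shows "lin_comb M c (\<lambda>i. v i \<ominus>\<^bsub>M\<^esub> w i) n = lin_comb M c v n \<ominus>\<^bsub>M\<^esub> lin_comb M c w n"
proof -
  have "lin_comb M c (\<lambda>i. v i \<ominus>\<^bsub>M\<^esub> w i) n = lin_comb M c (\<lambda>i. v i \<oplus>\<^bsub>M\<^esub> (\<ominus> \<one>) \<odot>\<^bsub>M\<^esub> w i) n"
    using assms by (intro lin_comb_cong) (auto simp: tuples_def M.minus_eq smult_l_minus)
  also have "\<dots> = lin_comb M c v n \<oplus>\<^bsub>M\<^esub> (\<ominus> \<one>) \<odot>\<^bsub>M\<^esub> lin_comb M c w n"
    using assms by (subst lin_comb_add_right)
      (auto intro!: tuplesI simp: tuplesD lin_comb_smult_right)
  also have "\<dots> = lin_comb M c v n \<ominus>\<^bsub>M\<^esub> lin_comb M c w n"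
    using assms by (simp add: smult_l_minus lin_comb_closed M.minus_eq)
  finally show ?thesis .
qed

lemma lin_comb_unit:
  assumes "i < n" "a \<in> carrier R" "v \<in> tuples (carrier M) n"
  shows "lin_comb M (\<lambda>j. if j = i then a else \<zero>) v n = a \<odot>\<^bsub>M\<^esub> v i"
  using assms
proof (induction n)
  case (Suc n)
  have t: "v \<in> tuples (carrier M) n" "v n \<in> carrier M"
    using Suc.prems by (auto intro: tuples_SucD)
  have u: "(\<lambda>j. if j = i then a else \<zero>) \<in> tuples (carrier R) (Suc n)"
    using Suc.prems by (auto simp: tuples_def)
  show ?case
  proof (cases "i = n")
    case True
    have "lin_comb M (\<lambda>j. if j = i then a else \<zero>) v n = lin_comb M (\<lambda>j. \<zero>) v n"
      using t True tuples_SucD(1)[OF u] by (intro lin_comb_cong) auto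
    then show ?thesis
      using True t u Suc.prems by (simp add: lin_comb_Suc lin_comb_zero_left)
  next
    case False
    then show ?thesis
      using t u Suc by (simp add: lin_comb_Suc tuplesD)
  qed
qed simp

lemma lin_comb_unit_right:
  assumes "i < n" "x \<in> carrier M" "c \<in> tuples (carrier R) n"
  shows "lin_comb M c (\<lambda>j. if j = i then x else \<zero>\<^bsub>M\<^esub>) n = c i \<odot>\<^bsub>M\<^esub> x"
  using assms
proof (induction n)
  case (Suc n)
  have t: "c \<in> tuples (carrier R) n" "c n \<in> carrier R"
    using Suc.prems by (auto intro: tuples_SucD)
  have u: "(\<lambda>j. if j = i then x else \<zero>\<^bsub>M\<^esub>) \<in> tuples (carrier M) (Suc n)"
    using Suc.prems by (auto simp: tuples_def)
  show ?case
  proof (cases "i = n")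
    case True
    have "lin_comb M c (\<lambda>j. if j = i then x else \<zero>\<^bsub>M\<^esub>) n = lin_comb M c (\<lambda>j. \<zero>\<^bsub>M\<^esub>) n"
      using t True tuples_SucD(1)[OF u] by (intro lin_comb_cong) auto
    then show ?thesis
      using True t u Suc.prems by (simp add: lin_comb_Suc lin_comb_zero_right)
  next
    case False
    then show ?thesis
      using t u Suc by (simp add: lin_comb_Suc tuplesD)
  qed
qed simp

text \<open>Associativity (cB)v = c(Bv) of the matrix product, with v a vector over the module and
  the entries of cB computed in the ring. It carries relations between matrices, such as d d = 0,
  over to \<open>M\<close>.\<close>

lemma lin_comb_assoc:
  assumes "c \<in> tuples (carrier R) n" "\<And>j. j < n \<Longrightarrow> B j \<in> tuples (carrier R) k"
    and "v \<in> tuples (carrier M) k"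
  shows "lin_comb M c (\<lambda>j. lin_comb M (B j) v k) n
       = lin_comb M (\<lambda>i. lin_comb (ring_module R) c (\<lambda>j. B j i) n) v k"
  using assms(2,3)
proof (induction k)
  case 0
  then show ?case using assms(1) by (simp add: lin_comb_zero_right)
next
  case (Suc k)
  interpret RM: lmodule R "ring_module R" by (simp add: lmodule_def R.module_ring_module)
  have t: "\<And>j. j < n \<Longrightarrow> B j \<in> tuples (carrier R) k" "\<And>j. j < n \<Longrightarrow> B j k \<in> carrier R"
    "v \<in> tuples (carrier M) k" "v k \<in> carrier M"
    using Suc.prems by (auto intro: tuples_SucD)
  have u: "(\<lambda>i. lin_comb (ring_module R) c (\<lambda>j. B j i) n) \<in> tuples (carrier R) (Suc k)"
    using RM.lin_comb_closed[OF assms(1)] Suc.prems by (auto simp: tuples_def)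
  have "lin_comb M c (\<lambda>j. lin_comb M (B j) v (Suc k)) n
     = lin_comb M c (\<lambda>j. B j k \<odot>\<^bsub>M\<^esub> v k \<oplus>\<^bsub>M\<^esub> lin_comb M (B j) v k) n"
    using Suc.prems assms(1) by (intro lin_comb_cong) (auto intro!: tuplesI simp: lin_comb_Suc t)
  also have "\<dots> = lin_comb M c (\<lambda>j. B j k \<odot>\<^bsub>M\<^esub> v k) n \<oplus>\<^bsub>M\<^esub> lin_comb M c (\<lambda>j. lin_comb M (B j) v k) n"
    using assms(1) t by (intro lin_comb_add_right) (auto intro!: tuplesI)
  also have "lin_comb M c (\<lambda>j. B j k \<odot>\<^bsub>M\<^esub> v k) n
     = lin_comb (ring_module R) c (\<lambda>j. B j k) n \<odot>\<^bsub>M\<^esub> v k"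
    using assms(1) t(2)
  proof (induction n)
    case (Suc n)
    have "(\<lambda>j. B j k \<odot>\<^bsub>M\<^esub> v k) \<in> tuples (carrier M) (Suc n)"
      "(\<lambda>j. B j k) \<in> tuples (carrier (ring_module R)) (Suc n)"
      using Suc.prems t by (auto simp: tuples_def)
    moreover from this have "lin_comb (ring_module R) c (\<lambda>j. B j k) n \<in> carrier R"
      using RM.lin_comb_closed[of c n] Suc.prems(1) tuples_SucD(1) by fastforce
    ultimately show ?case
      using Suc t tuples_SucD[OF Suc.prems(1)]
      by (simp add: lin_comb_Suc RM.lin_comb_Suc smult_l_distr smult_assoc1)
  qed (use t in auto)
  finally show ?case
    using u Suc t by (simp add: lin_comb_Suc)
qed

end

section \<open>Matrix identities over the ring\<close>

lemma (in cring) lin_comb_commute: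
  assumes "u \<in> tuples (carrier R) n" "v \<in> tuples (carrier R) n"
  shows "lin_comb (ring_module R) u v n = lin_comb (ring_module R) v u n"
proof -
  interpret RM: lmodule R "ring_module R" by (simp add: lmodule_def module_ring_module)
  show ?thesis unfolding lin_comb_def using assms
    by (intro RM.finsum_cong') (auto simp: tuples_def m_comm)
qed

text \<open>Exchange of two finite sums, obtained from associativity once commutativity has put the
  coefficients on the correct side.\<close>

lemma (in cring) lin_comb_swap:
  assumes "a \<in> tuples (carrier R) n" "b \<in> tuples (carrier R) k"
    and Z: "\<And>l i. l < k \<Longrightarrow> i < n \<Longrightarrow> Z l i \<in> carrier R"
  shows "lin_comb (ring_module R) a (\<lambda>i. lin_comb (ring_module R) b (\<lambda>l. Z l i) k) n
       = lin_comb (ring_module R) b (\<lambda>l. lin_comb (ring_module R) a (Z l) n) k"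
proof -
  interpret RM: lmodule R "ring_module R" by (simp add: lmodule_def module_ring_module)
  have Z': "i < n \<Longrightarrow> (\<lambda>l. Z l i) \<in> tuples (carrier R) k" "l < k \<Longrightarrow> Z l \<in> tuples (carrier R) n" for i l
    using Z by (auto simp: tuples_def)
  have c: "lin_comb (ring_module R) b (\<lambda>l. Z l i) k \<in> carrier R"
    if "i < n" for i using RM.lin_comb_closed[OF assms(2)] Z'(1)[OF that] by simp
  have c': "lin_comb (ring_module R) a (Z l) n \<in> carrier R"
    if "l < k" for l using RM.lin_comb_closed[OF assms(1)] Z'(2)[OF that] by simp
  have "lin_comb (ring_module R) a (\<lambda>i. lin_comb (ring_module R) b (\<lambda>l. Z l i) k) n
     = lin_comb (ring_module R) a (\<lambda>i. lin_comb (ring_module R) (\<lambda>l. Z l i) b k) n"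
    using assms c Z' by (rule_tac RM.lin_comb_cong) (auto intro!: tuplesI lin_comb_commute)
  also have "\<dots> = lin_comb (ring_module R) (\<lambda>l. lin_comb (ring_module R) a (Z l) n) b k"
    using assms Z' by (subst RM.lin_comb_assoc) auto
  also have "\<dots> = lin_comb (ring_module R) b (\<lambda>l. lin_comb (ring_module R) a (Z l) n) k"
    using c' assms by (intro lin_comb_commute) (auto intro!: tuplesI)
  finally show ?thesis .
qed

subsection \<open>Submodules spanned with coefficients in an ideal\<close>

text \<open>Finite sums built one term at a time, so that rule induction replaces bookkeeping with
  tuples. With \<open>K\<close> the whole ring this is the ordinary span of \<open>G\<close>; with
  \<open>K\<close> an ideal it is \<open>K\<close> times that span.\<close>

inductive_set span_over :: "('a, 'm) module \<Rightarrow> 'a set \<Rightarrow> 'm set \<Rightarrow> 'm set"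
  for M :: "('a, 'm) module" and K :: "'a set" and G :: "'m set" where
  zero: "\<zero>\<^bsub>M\<^esub> \<in> span_over M K G"
| add: "\<lbrakk>c \<in> K; x \<in> G; y \<in> span_over M K G\<rbrakk> \<Longrightarrow> c \<odot>\<^bsub>M\<^esub> x \<oplus>\<^bsub>M\<^esub> y \<in> span_over M K G"

context lmodule
begin

lemma span_over_closed:
  assumes "x \<in> span_over M K G" "K \<subseteq> carrier R" "G \<subseteq> carrier M"
  shows "x \<in> carrier M"
  using assms by induction (auto intro!: smult_closed)

lemma span_over_subset:
  assumes "x \<in> span_over M K G" "submodule H R M" "\<And>c y. c \<in> K \<Longrightarrow> y \<in> G \<Longrightarrow> c \<odot>\<^bsub>M\<^esub> y \<in> H"
  shows "x \<in> H"
  using assms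
proof induction
  case zero
  then show ?case using subgroup.one_closed[OF submodule.axioms(1)] by fastforce
next
  case (add c x y)
  then show ?case by (simp add: submoduleE(5))
qed

lemma smult_in_span_over:
  assumes "c \<in> K" "x \<in> G" "K \<subseteq> carrier R" "G \<subseteq> carrier M"
  shows "c \<odot>\<^bsub>M\<^esub> x \<in> span_over M K G"
proof -
  have "c \<odot>\<^bsub>M\<^esub> x \<oplus>\<^bsub>M\<^esub> \<zero>\<^bsub>M\<^esub> \<in> span_over M K G"
    using assms by (intro span_over.intros)
  moreover have "c \<odot>\<^bsub>M\<^esub> x \<in> carrier M"
    using assms by (auto intro: smult_closed)
  ultimately show ?thesis by simp
qed

lemma span_over_add:
  assumes "x \<in> span_over M K G" "y \<in> span_over M K G" "K \<subseteq> carrier R" "G \<subseteq> carrier M"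
  shows "x \<oplus>\<^bsub>M\<^esub> y \<in> span_over M K G"
  using assms
proof induction
  case zero
  then show ?case by (simp add: span_over_closed)
next
  case (add c x z)
  then have "c \<odot>\<^bsub>M\<^esub> x \<oplus>\<^bsub>M\<^esub> (z \<oplus>\<^bsub>M\<^esub> y) \<in> span_over M K G"
    by (intro span_over.intros) auto
  moreover have "c \<odot>\<^bsub>M\<^esub> x \<in> carrier M" "z \<in> carrier M" "y \<in> carrier M"
    using add by (auto intro: smult_closed span_over_closed)
  ultimately show ?case by (simp add: M.a_assoc)
qed

lemma span_over_smult:
  assumes "x \<in> span_over M K G" "a \<in> carrier R" "ideal K R" "G \<subseteq> carrier M"
  shows "a \<odot>\<^bsub>M\<^esub> x \<in> span_over M K G"
  using assms
proof induction
  case zero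
  then show ?case by (simp add: span_over.zero)
next
  case (add c x z)
  have K: "K \<subseteq> carrier R" by (rule additive_subgroup.a_subset[OF ideal.axioms(1)[OF \<open>ideal K R\<close>]])
  have "(a \<otimes> c) \<odot>\<^bsub>M\<^esub> x \<oplus>\<^bsub>M\<^esub> a \<odot>\<^bsub>M\<^esub> z \<in> span_over M K G"
    using add by (intro span_over.intros) (auto intro: ideal.I_l_closed)
  moreover have "x \<in> carrier M" "c \<in> carrier R" "z \<in> carrier M"
    using add K by (auto intro: span_over_closed)
  ultimately show ?case using \<open>a \<in> carrier R\<close> by (simp add: smult_assoc1 smult_r_distr)
qed

lemma span_over_submodule:
  assumes "ideal K R" "G \<subseteq> carrier M"
  shows "submodule (span_over M K G) R M"
proof (rule submoduleI)
  have K: "K \<subseteq> carrier R" by (rule additive_subgroup.a_subset[OF ideal.axioms(1)[OF assms(1)]])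
  show "span_over M K G \<subseteq> carrier M" using span_over_closed K assms by blast
  show "\<ominus>\<^bsub>M\<^esub> x \<in> span_over M K G" if "x \<in> span_over M K G" for x
    using span_over_smult[OF that, of "\<ominus> \<one>"] assms span_over_closed[OF that K]
    by (simp add: smult_l_minus)
qed (use assms in \<open>auto intro: span_over.zero span_over_add span_over_smult
      additive_subgroup.a_Hcarr[OF ideal.axioms(1)]\<close>)

text \<open>All occurrences of \<open>g\<close> in the sum are collected into a single coefficient,
  which stays in \<open>K\<close> because an ideal is closed under addition. This is the elimination
  step behind Nakayama.\<close>

lemma span_over_insert:
  assumes "x \<in> span_over M K (insert g G)" "ideal K R" "insert g G \<subseteq> carrier M"
  obtains c y where "c \<in> K" "y \<in> span_over M K G" "x = c \<odot>\<^bsub>M\<^esub> g \<oplus>\<^bsub>M\<^esub> y"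
  using assms
proof (induction arbitrary: thesis)
  case zero
  have "\<zero> \<in> K" by (rule additive_subgroup.zero_closed[OF ideal.axioms(1)[OF zero(2)]])
  then show ?case
    by (rule zero(1)[of _ "\<zero>\<^bsub>M\<^esub>"]) (use zero(3) in \<open>auto intro: span_over.zero\<close>)
next
  case (add c x z)
  interpret K: ideal K R by fact
  from add obtain c' y where c': "c' \<in> K" "y \<in> span_over M K G" "z = c' \<odot>\<^bsub>M\<^esub> g \<oplus>\<^bsub>M\<^esub> y"
    by metis
  have y: "y \<in> carrier M" using c' add span_over_closed K.a_subset by auto
  have car: "c \<in> carrier R" "c' \<in> carrier R" using c' add K.a_subset by auto
  show ?case
  proof (cases "x = g")
    case True
    have "c \<odot>\<^bsub>M\<^esub> x \<oplus>\<^bsub>M\<^esub> z = (c \<oplus> c') \<odot>\<^bsub>M\<^esub> g \<oplus>\<^bsub>M\<^esub> y"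
      using True c' y car add.prems by (simp add: smult_l_distr M.a_assoc)
    then show ?thesis using add.prems(1)[of "c \<oplus> c'" y] c' add.hyps by simp
  next
    case False
    have "x \<in> carrier M" using add by auto
    then have "c \<odot>\<^bsub>M\<^esub> x \<oplus>\<^bsub>M\<^esub> z = c' \<odot>\<^bsub>M\<^esub> g \<oplus>\<^bsub>M\<^esub> (c \<odot>\<^bsub>M\<^esub> x \<oplus>\<^bsub>M\<^esub> y)"
      using c' y car add.prems by (simp add: M.add.m_ac)
    then show ?thesis
      using add.prems(1)[of c' "c \<odot>\<^bsub>M\<^esub> x \<oplus>\<^bsub>M\<^esub> y"] c' add.hyps False
      by (auto intro: span_over.intros)
  qed
qed

lemma span_over_annihilated:
  assumes "x \<in> span_over M K G" "K \<subseteq> carrier R" "G \<subseteq> carrier M" "s \<in> carrier R"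
    and "\<And>g. g \<in> G \<Longrightarrow> s \<odot>\<^bsub>M\<^esub> g = \<zero>\<^bsub>M\<^esub>"
  shows "s \<odot>\<^bsub>M\<^esub> x = \<zero>\<^bsub>M\<^esub>"
  using assms
proof induction
  case (add c x z)
  have car: "c \<in> carrier R" "x \<in> carrier M" "z \<in> carrier M"
    using add by (auto intro: span_over_closed)
  have "s \<odot>\<^bsub>M\<^esub> (c \<odot>\<^bsub>M\<^esub> x) = c \<odot>\<^bsub>M\<^esub> (s \<odot>\<^bsub>M\<^esub> x)"
    using car add.prems by (simp flip: smult_assoc1 add: R.m_comm)
  then show ?case using car add by (simp add: smult_r_distr)
qed simp

lemma lin_comb_in_span_over:
  assumes "c \<in> tuples K n" "v \<in> tuples G n" "K \<subseteq> carrier R" "G \<subseteq> carrier M"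
  shows "lin_comb M c v n \<in> span_over M K G"
  using assms
proof (induction n)
  case (Suc n)
  have "c \<in> tuples (carrier R) (Suc n)" "v \<in> tuples (carrier M) (Suc n)"
    using Suc.prems by (auto simp: tuples_def)
  then show ?case using Suc tuples_SucD[OF Suc.prems(1)] tuples_SucD[OF Suc.prems(2)]
    by (auto simp: lin_comb_Suc intro: span_over.add)
qed (simp add: span_over.zero)

text \<open>Links the products of ideals and submodules in the hypotheses, given by tuples of
  arbitrary length, to the inductive form. A term is added by placing it at the end of the
  tuple.\<close>

lemma ideal_smult_eq_span_over:
  assumes "K \<subseteq> carrier R" "G \<subseteq> carrier M"
  shows "ideal_smult R M K G = span_over M K G"
proof (intro equalityI subsetI)
  fix x assume "x \<in> span_over M K G"
  then show "x \<in> ideal_smult R M K G"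
  proof induction
    case zero
    then show ?case unfolding ideal_smult_def by (force intro: exI[of _ 0] simp: tuples_def)
  next
    case (add c x z)
    then obtain a v n where n: "a \<in> tuples K n" "v \<in> tuples G n" "z = lin_comb M a v n"
      by (auto simp: ideal_smult_def)
    have "a(n := c) \<in> tuples K (Suc n)" "v(n := x) \<in> tuples G (Suc n)"
      using n add by (auto simp: tuples_def)
    moreover have "lin_comb M (a(n := c)) (v(n := x)) (Suc n) = c \<odot>\<^bsub>M\<^esub> x \<oplus>\<^bsub>M\<^esub> z"
    proof -
      have "lin_comb M (a(n := c)) (v(n := x)) (Suc n)
          = c \<odot>\<^bsub>M\<^esub> x \<oplus>\<^bsub>M\<^esub> lin_comb M (a(n := c)) (v(n := x)) n"
        using calculation assms by (subst lin_comb_Suc) (auto simp: tuples_def subset_iff)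
      also have "lin_comb M (a(n := c)) (v(n := x)) n = z"
        unfolding n(3) using n assms by (intro lin_comb_cong) (auto simp: tuples_def subset_iff)
      finally show ?thesis .
    qed
    ultimately show ?case unfolding ideal_smult_def by (smt (verit) mem_Collect_eq)
  qed
qed (auto simp: ideal_smult_def intro!: lin_comb_in_span_over assms)

end

section \<open>Nakayama's lemma at a prime ideal, with denominators cleared\<close>

lemma (in primeideal) nonmember_mult:
  "s \<in> carrier R - I \<Longrightarrow> s' \<in> carrier R - I \<Longrightarrow> s \<otimes> s' \<in> carrier R - I"
  using I_prime by auto

text \<open>In the localization this says that a unit minus an element of the maximal ideal is again
  a unit.\<close>

lemma (in primeideal) nonmember_minus:
  assumes "s \<in> carrier R - I" "c \<in> I"
  shows "s \<ominus> c \<in> carrier R - I"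
proof -
  have "c \<in> carrier R" using assms a_subset by auto
  moreover have "s \<in> I" if "s \<ominus> c \<in> I"
  proof -
    have "(s \<ominus> c) \<oplus> c \<in> I" using that assms by simp
    then show ?thesis using assms \<open>c \<in> carrier R\<close> by (simp add: minus_eq a_assoc l_neg)
  qed
  ultimately show ?thesis using assms by auto
qed

text \<open>Eliminating one generator at a time replaces the determinant trick.\<close>

lemma (in lmodule) nakayama_at_prime:
  assumes "primeideal p R" "finite G" "G \<subseteq> carrier M" "s \<in> carrier R - p"
    and "\<And>g. g \<in> G \<Longrightarrow> s \<odot>\<^bsub>M\<^esub> g \<in> span_over M p G"
  shows "\<exists>s' \<in> carrier R - p. \<forall>g \<in> G. s' \<odot>\<^bsub>M\<^esub> g = \<zero>\<^bsub>M\<^esub>"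
  using assms(2-5)
proof (induction G arbitrary: s)
  case (insert k G)
  interpret p: primeideal p R by fact
  have p: "ideal p R" by (rule p.ideal_axioms)
  have k: "k \<in> carrier M" and G: "G \<subseteq> carrier M" and sR: "s \<in> carrier R" using insert by auto
  obtain c u where c: "c \<in> p" "u \<in> span_over M p G" "s \<odot>\<^bsub>M\<^esub> k = c \<odot>\<^bsub>M\<^esub> k \<oplus>\<^bsub>M\<^esub> u"
    by (rule span_over_insert[OF insert.prems(3)[OF insertI1] p insert.prems(1)])
  \<comment> \<open>The pivot: moving the \<open>k\<close>-term to the left gives (s - c) k = u,
    where u involves only the remaining generators and s - c is still outside
    \<open>p\<close>.\<close>
  define s1 where "s1 = s \<ominus> c"
  have s1: "s1 \<in> carrier R - p" unfolding s1_def by (rule p.nonmember_minus[OF insert.prems(2) c(1)])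
  have u: "u \<in> carrier M" using c G p.a_subset by (auto intro: span_over_closed)
  have cR: "c \<in> carrier R" using c p.a_subset by auto
  have s1k: "s1 \<odot>\<^bsub>M\<^esub> k = u"
  proof -
    have "s1 \<odot>\<^bsub>M\<^esub> k = s \<odot>\<^bsub>M\<^esub> k \<oplus>\<^bsub>M\<^esub> \<ominus>\<^bsub>M\<^esub> (c \<odot>\<^bsub>M\<^esub> k)"
      using sR cR k by (simp add: s1_def R.minus_eq smult_l_distr smult_l_minus)
    also have "\<dots> = u"
      unfolding c(3) using sR cR k u by (subst M.a_comm[of _ u]) (simp_all add: M.a_assoc M.r_neg)
    finally show ?thesis .
  qed
  \<comment> \<open>Multiplying a relation by the pivot replaces \<open>k\<close> by
    \<open>u\<close>, so the relations survive with generators \<open>G\<close> alone and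
    denominator \<open>s1\<close> times \<open>s\<close>.\<close>
  have "(s1 \<otimes> s) \<odot>\<^bsub>M\<^esub> g \<in> span_over M p G" if gG: "g \<in> G" for g
  proof -
    obtain e v where e: "e \<in> p" "v \<in> span_over M p G" "s \<odot>\<^bsub>M\<^esub> g = e \<odot>\<^bsub>M\<^esub> k \<oplus>\<^bsub>M\<^esub> v"
      by (rule span_over_insert[OF insert.prems(3)[OF insertI2[OF gG]] p insert.prems(1)])
    have car: "e \<in> carrier R" "v \<in> carrier M" "g \<in> carrier M"
      using e G gG p.a_subset by (auto intro: span_over_closed)
    have "(s1 \<otimes> s) \<odot>\<^bsub>M\<^esub> g = s1 \<odot>\<^bsub>M\<^esub> (e \<odot>\<^bsub>M\<^esub> k) \<oplus>\<^bsub>M\<^esub> s1 \<odot>\<^bsub>M\<^esub> v"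
      using s1 sR car k by (simp add: smult_assoc1 e(3) smult_r_distr)
    also have "s1 \<odot>\<^bsub>M\<^esub> (e \<odot>\<^bsub>M\<^esub> k) = e \<odot>\<^bsub>M\<^esub> u"
      unfolding s1k[symmetric] using s1 car k by (simp flip: smult_assoc1 add: R.m_comm)
    finally show ?thesis
      using s1 car e c G p p.a_subset by (simp add: span_over_add span_over_smult)
  qed
  with insert.IH[OF G p.nonmember_mult[OF s1 insert.prems(2)]]
  obtain s' where s': "s' \<in> carrier R - p" "\<forall>g\<in>G. s' \<odot>\<^bsub>M\<^esub> g = \<zero>\<^bsub>M\<^esub>" by blast
  \<comment> \<open>The pivot sends \<open>k\<close> to \<open>u\<close> in the span of
    \<open>G\<close>, and \<open>s'\<close> then kills it.\<close>
  have "(s' \<otimes> s1) \<odot>\<^bsub>M\<^esub> g = \<zero>\<^bsub>M\<^esub>" if "g \<in> insert k G" for g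
  proof (cases "g = k")
    case True
    then have "(s' \<otimes> s1) \<odot>\<^bsub>M\<^esub> g = s' \<odot>\<^bsub>M\<^esub> u"
      using s' s1 k by (simp add: smult_assoc1 s1k)
    then show ?thesis
      using span_over_annihilated[OF c(2)] s' G p.a_subset by simp
  next
    case False
    then have "(s' \<otimes> s1) \<odot>\<^bsub>M\<^esub> g = s1 \<odot>\<^bsub>M\<^esub> (s' \<odot>\<^bsub>M\<^esub> g)"
      using that s' s1 G by (subst R.m_comm) (auto simp: smult_assoc1)
    then show ?thesis using False that s' s1 by simp
  qed
  then show ?case using p.nonmember_mult[OF s'(1) s1] by blast
qed (use assms(4) in auto)

subsection \<open>Noetherian local rings\<close>

text \<open>By the ascending chain condition the union of a nonempty chain of ideals is a member of
  the chain, hence an upper bound inside the family, and Zorn applies.\<close>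

lemma (in noetherian_ring) ex_maximal_ideal_in_family:
  assumes "S \<noteq> {}" "\<And>I. I \<in> S \<Longrightarrow> ideal I R"
  shows "\<exists>I\<in>S. \<forall>K\<in>S. I \<subseteq> K \<longrightarrow> K = I"
proof (rule subset_Zorn_nonempty[OF assms(1)])
  fix C assume C: "C \<noteq> {}" "subset.chain S C"
  have "subset.chain {I. ideal I R} C"
    using C(2) assms(2) by (auto simp: subset.chain_def)
  then have "\<Union>C \<in> C" by (rule ideal_chain_is_trivial[OF C(1)])
  then show "\<Union>C \<in> S" using C(2) by (auto simp: subset.chain_def)
qed

text \<open>A non-unit generates a proper ideal. A largest proper ideal containing it is maximal, so
  it equals \<open>m\<close>, contradicting that \<open>s\<close> lies outside
  \<open>m\<close>.\<close>

lemma noeth_local_ring_unit: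
  fixes R (structure)
  assumes "noeth_local_ring R m" "s \<in> carrier R - m"
  shows "s \<in> Units R"
proof (rule ccontr)
  assume nu: "s \<notin> Units R"
  interpret cring R using assms by (simp add: noeth_local_ring_def)
  interpret noetherian_ring R using assms by (simp add: noeth_local_ring_def)
  let ?S = "{I. ideal I R \<and> s \<in> I \<and> \<one> \<notin> I}"
  have s: "s \<in> carrier R" using assms by auto
  have "\<one> \<notin> PIdl s"
  proof
    assume "\<one> \<in> PIdl s"
    then obtain r where "r \<in> carrier R" "\<one> = r \<otimes> s" by (auto simp: cgenideal_def)
    then have "s \<in> Units R" using s by (auto simp: Units_def m_comm)
    then show False using nu by simp
  qed
  then have "PIdl s \<in> ?S" using s by (auto intro: cgenideal_ideal cgenideal_self)
  then obtain I where I: "I \<in> ?S" "\<forall>K\<in>?S. I \<subseteq> K \<longrightarrow> K = I"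
    using ex_maximal_ideal_in_family[of ?S] by blast
  have "maximalideal I R"
  proof (rule maximalidealI)
    show "ideal I R" "carrier R \<noteq> I" using I by auto
    fix K assume K: "ideal K R" "I \<subseteq> K" "K \<subseteq> carrier R"
    show "K = I \<or> K = carrier R"
      using I K ideal.one_imp_carrier[OF K(1)] by blast
  qed
  then show False using assms I by (auto simp: noeth_local_ring_def)
qed

text \<open>Among the annihilators of nonzero elements that contain the annihilator of \<open>x\<close>, a maximal
  one is prime.\<close>

lemma (in cring) zero_if_zero_at_ass:
  assumes "noetherian_ring R" "x \<in> carrier R"
    and loc: "\<And>p. p \<in> ass_ring R \<Longrightarrow> \<exists>s \<in> carrier R - p. s \<otimes> x = \<zero>"
  shows "x = \<zero>"
proof (rule ccontr)
  assume "x \<noteq> \<zero>"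
  interpret noetherian_ring R by fact
  define ann where "ann r = {s \<in> carrier R. s \<otimes> r = \<zero>}" for r
  have comm: "a \<otimes> (y \<otimes> r) = \<zero>" if "a \<otimes> r = \<zero>" "a \<in> carrier R" "y \<in> carrier R" "r \<in> carrier R"
    for a y r using that by (subst m_lcomm) simp_all
  have ann: "ideal (ann r) R" if r: "r \<in> carrier R" for r
  proof (rule idealI)
    show "subgroup (ann r) (add_monoid R)"
    proof (rule add.subgroupI)
      show "ann r \<noteq> {}" using r unfolding ann_def by (metis (mono_tags, lifting) empty_Collect_eq l_null zero_closed)
      show "\<ominus> a \<in> ann r" if "a \<in> ann r" for a
        using that r by (simp add: ann_def l_minus)
    qed (use r in \<open>auto simp: ann_def l_distr\<close>)
    show "y \<otimes> a \<in> ann r" "a \<otimes> y \<in> ann r" if "a \<in> ann r" "y \<in> carrier R" for a y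
      using that r by (simp_all add: ann_def m_assoc comm)
  qed (rule ring_axioms)
  let ?S = "{ann r | r. r \<in> carrier R \<and> r \<noteq> \<zero> \<and> ann x \<subseteq> ann r}"
  obtain I where I: "I \<in> ?S" "\<forall>K\<in>?S. I \<subseteq> K \<longrightarrow> K = I"
  proof -
    have "?S \<noteq> {}" using \<open>x \<noteq> \<zero>\<close> assms(2) by auto
    moreover have "ideal K R" if "K \<in> ?S" for K using that ann by auto
    ultimately have "\<exists>I\<in>?S. \<forall>K\<in>?S. I \<subseteq> K \<longrightarrow> K = I" by (rule ex_maximal_ideal_in_family)
    then show thesis using that by blast
  qed
  from I(1) obtain r where r: "r \<in> carrier R" "r \<noteq> \<zero>" "ann x \<subseteq> ann r" and Ir: "I = ann r"
    by auto
  have max: "ann r' = ann r" if "r' \<in> carrier R" "r' \<noteq> \<zero>" "ann r \<subseteq> ann r'" for r'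
  proof -
    have "ann r' \<in> ?S" using that r(3) by auto
    then show ?thesis using I(2) that(3) unfolding Ir by blast
  qed
  have "primeideal (ann r) R"
  proof (rule primeidealI)
    show "ideal (ann r) R" "cring R" using ann r is_cring by auto
    have "\<one> \<notin> ann r" using r by (auto simp: ann_def)
    then show "carrier R \<noteq> ann r" by auto
    fix a b assume ab: "a \<in> carrier R" "b \<in> carrier R" "a \<otimes> b \<in> ann r"
    show "a \<in> ann r \<or> b \<in> ann r"
    proof (cases "b \<otimes> r = \<zero>")
      case True
      then show ?thesis using ab by (simp add: ann_def)
    next
      case False
      \<comment> \<open>Whatever kills \<open>r\<close> kills \<open>b\<close> times
        \<open>r\<close>, so maximality makes the two annihilators equal; and \<open>a\<close> kills
        \<open>b\<close> times \<open>r\<close>.\<close>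
      have "ann r \<subseteq> ann (b \<otimes> r)"
        using ab r by (auto simp: ann_def comm)
      then have "ann (b \<otimes> r) = ann r" using max[of "b \<otimes> r"] False ab r(1) by auto
      moreover have "a \<in> ann (b \<otimes> r)" using ab r by (simp add: ann_def m_assoc)
      ultimately show ?thesis by simp
    qed
  qed
  then have "ann r \<in> ass_ring R" using r by (auto simp: ass_ring_def ann_def)
  \<comment> \<open>The denominator \<open>s\<close> kills \<open>x\<close>, hence lies in
    \<open>ann x\<close>, which is contained in \<open>ann r\<close>: a contradiction.\<close>
  from loc[OF this] obtain s where "s \<in> carrier R - ann r" "s \<otimes> x = \<zero>" by blast
  then show False using r by (auto simp: ann_def)
qed

subsection \<open>Annihilation of \<open>JX\<close>\<close>

context lmodule
begin

lemma smult_left_comm: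
  "\<lbrakk>a \<in> carrier R; b \<in> carrier R; x \<in> carrier M\<rbrakk> \<Longrightarrow> a \<odot>\<^bsub>M\<^esub> (b \<odot>\<^bsub>M\<^esub> x) = b \<odot>\<^bsub>M\<^esub> (a \<odot>\<^bsub>M\<^esub> x)"
  by (simp flip: smult_assoc1 add: R.m_comm)

lemma smult_inv_cancel:
  assumes "s \<in> Units R" "x \<in> carrier M"
  shows "inv\<^bsub>R\<^esub> s \<odot>\<^bsub>M\<^esub> (s \<odot>\<^bsub>M\<^esub> x) = x"
proof -
  have "s \<in> carrier R" "inv\<^bsub>R\<^esub> s \<in> carrier R" "inv\<^bsub>R\<^esub> s \<otimes> s = \<one>" using assms by auto
  then show ?thesis using assms(2) by (simp flip: smult_assoc1)
qed

lemma lin_comb_in_submodule: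
  assumes "submodule H R M" "\<And>j. j < n \<Longrightarrow> c j \<odot>\<^bsub>M\<^esub> v j \<in> H"
    and "c \<in> tuples (carrier R) n" "v \<in> tuples (carrier M) n"
  shows "lin_comb M c v n \<in> H"
  using assms(2-)
proof (induction n)
  case 0
  then show ?case using subgroup.one_closed[OF submodule.axioms(1)[OF assms(1)]] by simp
next
  case (Suc n)
  then show ?case using tuples_SucD(1)[OF Suc.prems(2)] tuples_SucD(1)[OF Suc.prems(3)]
    by (simp add: lin_comb_Suc submoduleE(5)[OF assms(1)])
qed

text \<open>Since the scalars carrying \<open>x\<close> into \<open>H\<close> form an ideal,
  membership for a generated ideal or a product of ideals need only be tested on generators.\<close>

lemma ideal_smult_into_submodule:
  assumes H: "submodule H R M" and x: "x \<in> carrier M"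
  shows "ideal {r \<in> carrier R. r \<odot>\<^bsub>M\<^esub> x \<in> H} R"
proof (rule idealI)
  show "ring R" by (rule R.ring_axioms)
  have zero: "\<zero>\<^bsub>M\<^esub> \<in> H" using subgroup.one_closed[OF submodule.axioms(1)[OF H]] by simp
  show "subgroup {r \<in> carrier R. r \<odot>\<^bsub>M\<^esub> x \<in> H} (add_monoid R)"
  proof (rule R.add.subgroupI)
    show "{r \<in> carrier R. r \<odot>\<^bsub>M\<^esub> x \<in> H} \<noteq> {}"
      using zero x by (auto intro!: exI[of _ \<zero>])
  qed (use x submoduleE(3,5)[OF H] in \<open>auto simp: smult_l_distr smult_l_minus\<close>)
  show "y \<otimes> a \<in> {r \<in> carrier R. r \<odot>\<^bsub>M\<^esub> x \<in> H}"
    if "a \<in> {r \<in> carrier R. r \<odot>\<^bsub>M\<^esub> x \<in> H}" "y \<in> carrier R" for a y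
    using that x submoduleE(4)[OF H] by (simp add: smult_assoc1)
  then show "a \<otimes> y \<in> {r \<in> carrier R. r \<odot>\<^bsub>M\<^esub> x \<in> H}"
    if "a \<in> {r \<in> carrier R. r \<odot>\<^bsub>M\<^esub> x \<in> H}" "y \<in> carrier R" for a y
    using that by (auto simp: R.m_comm[of a y])
qed

lemma genideal_smult_in_submodule:
  assumes "submodule H R M" "x \<in> carrier M" "S \<subseteq> carrier R" "\<And>a. a \<in> S \<Longrightarrow> a \<odot>\<^bsub>M\<^esub> x \<in> H"
    and "r \<in> Idl S"
  shows "r \<odot>\<^bsub>M\<^esub> x \<in> H"
  using R.genideal_minimal[OF ideal_smult_into_submodule[OF assms(1,2)], of S] assms(3-5) by auto

lemma ideal_prod_smult_in_submodule:
  assumes "submodule H R M" "x \<in> carrier M" "I \<subseteq> carrier R" "K \<subseteq> carrier R"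
    and "\<And>a b. a \<in> I \<Longrightarrow> b \<in> K \<Longrightarrow> a \<odot>\<^bsub>M\<^esub> (b \<odot>\<^bsub>M\<^esub> x) \<in> H"
    and "r \<in> ideal_prod_set R I K"
  shows "r \<odot>\<^bsub>M\<^esub> x \<in> H"
  by (rule genideal_smult_in_submodule[OF assms(1,2) _ _ assms(6)[unfolded ideal_prod_set_def]])
    (use assms in \<open>auto simp: smult_assoc1 subset_iff\<close>)

text \<open>The factor \<open>a\<close> is absorbed into each coefficient, and every product of it
  with a ring element lies in \<open>K\<close>.\<close>

lemma smult_span_over_carrier:
  assumes "x \<in> span_over M (carrier R) G" "a \<in> K" "ideal K R" "G \<subseteq> carrier M"
  shows "a \<odot>\<^bsub>M\<^esub> x \<in> span_over M K G"
  using assms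
proof induction
  case zero
  then show ?case by (simp add: span_over.zero additive_subgroup.a_Hcarr[OF ideal.axioms(1)])
next
  case (add c x z)
  interpret K: ideal K R by fact
  have car: "x \<in> carrier M" "z \<in> carrier M" "a \<in> carrier R"
    using add K.a_subset by (auto intro: span_over_closed)
  have "(a \<otimes> c) \<odot>\<^bsub>M\<^esub> x \<oplus>\<^bsub>M\<^esub> a \<odot>\<^bsub>M\<^esub> z \<in> span_over M K G"
    using add by (intro span_over.intros) (auto intro: K.I_r_closed)
  then show ?case using car add.hyps by (simp add: smult_assoc1 smult_r_distr)
qed

text \<open>The products of finitely many generators of \<open>J\<close> with finitely many
  generators of the module span JM. Their finiteness is what Nakayama requires later.\<close>

lemma finite_generators_ideal_smult:
  assumes "noetherian_ring R" "finitely_generated R M" "ideal J R"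
  shows "\<exists>W. finite W \<and> W \<subseteq> {a \<odot>\<^bsub>M\<^esub> x | a x. a \<in> J \<and> x \<in> carrier M} \<and>
    (\<forall>a\<in>J. \<forall>x\<in>carrier M. a \<odot>\<^bsub>M\<^esub> x \<in> span_over M (carrier R) W)"
proof -
  interpret J: ideal J R by fact
  obtain S where S: "S \<subseteq> carrier R" "finite S" "J = Idl S"
    using noetherian_ring.finetely_gen[OF assms(1,3)] by blast
  have SJ: "S \<subseteq> J" using S R.genideal_self by auto
  obtain n g where g: "g \<in> tuples (carrier M) n"
    "\<And>x. x \<in> carrier M \<Longrightarrow> \<exists>c \<in> tuples (carrier R) n. x = lin_comb M c g n"
    using assms(2) unfolding finitely_generated_def by blast
  define W where "W = (\<lambda>(a, i). a \<odot>\<^bsub>M\<^esub> g i) ` (S \<times> {..<n})"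
  have W: "W \<subseteq> {a \<odot>\<^bsub>M\<^esub> x | a x. a \<in> J \<and> x \<in> carrier M}"
    using SJ g(1) by (fastforce simp: W_def tuples_def)
  have Wc: "W \<subseteq> carrier M" using W J.a_subset by auto
  have sub: "submodule (span_over M (carrier R) W) R M"
    by (rule span_over_submodule[OF R.oneideal Wc])
  have S_smult: "a \<odot>\<^bsub>M\<^esub> x \<in> span_over M (carrier R) W" if a: "a \<in> S" and x: "x \<in> carrier M" for a x
  proof -
    obtain c where c: "c \<in> tuples (carrier R) n" "x = lin_comb M c g n" using g(2) x by blast
    have aR: "a \<in> carrier R" using a S by auto
    have "a \<odot>\<^bsub>M\<^esub> x = lin_comb M c (\<lambda>i. a \<odot>\<^bsub>M\<^esub> g i) n"
      unfolding c(2) by (rule lin_comb_smult_right[symmetric, OF c(1) g(1) aR])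
    also have "\<dots> \<in> span_over M (carrier R) W"
    proof (rule lin_comb_in_submodule[OF sub _ c(1)])
      show "(\<lambda>i. a \<odot>\<^bsub>M\<^esub> g i) \<in> tuples (carrier M) n" using g(1) aR by (auto simp: tuples_def)
      fix i assume "i < n"
      then show "c i \<odot>\<^bsub>M\<^esub> (a \<odot>\<^bsub>M\<^esub> g i) \<in> span_over M (carrier R) W"
        using a Wc c by (intro smult_in_span_over) (force simp: W_def tuples_def)+
    qed
    finally show ?thesis .
  qed
  show ?thesis
  proof (intro exI[of _ W] conjI ballI W)
    show "finite W" using S by (simp add: W_def)
    show "a \<odot>\<^bsub>M\<^esub> x \<in> span_over M (carrier R) W" if "a \<in> J" "x \<in> carrier M" for a x
      using genideal_smult_in_submodule[OF sub that(2) S(1)] S_smult that S(3) by auto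
  qed
qed

text \<open>The maximal ideal kills a simple module. If ax were outside \<open>H\<close>, simplicity
  would give x = c a x + h with h in \<open>H\<close>; then (1 - ca)x lies in \<open>H\<close>, and
  1 - ca is a unit.\<close>

lemma simple_quotient_annihilated:
  assumes loc: "noeth_local_ring R m" and H: "submodule H R M" and H': "submodule H' R M" "H \<subset> H'"
    and max: "\<not> (\<exists>K. submodule K R M \<and> H \<subset> K \<and> K \<subset> H')"
    and a: "a \<in> m" and x: "x \<in> H'"
  shows "a \<odot>\<^bsub>M\<^esub> x \<in> H"
proof (rule ccontr)
  assume notin: "a \<odot>\<^bsub>M\<^esub> x \<notin> H"
  interpret m: primeideal m R
    using loc R.maximalideal_prime by (auto simp: noeth_local_ring_def)
  have Hc: "H \<subseteq> carrier M" using submoduleE(1)[OF H] .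
  have xc: "x \<in> carrier M" using submoduleE(1)[OF H'(1)] x by auto
  have aR: "a \<in> carrier R" using a m.a_subset by auto
  define y where "y = a \<odot>\<^bsub>M\<^esub> x"
  have yc: "y \<in> carrier M" using aR xc by (simp add: y_def)
  have yH': "y \<in> H'" using submoduleE(4)[OF H'(1) aR x] by (simp add: y_def)
  have ins: "insert y H \<subseteq> carrier M" using Hc yc by auto
  \<comment> \<open>The submodule generated by \<open>H\<close> and ax lies strictly above
    \<open>H\<close> and inside \<open>H'\<close>, so it must be all of \<open>H'\<close>.\<close>
  let ?K = "span_over M (carrier R) (insert y H)"
  have gen: "h \<in> ?K" if "h \<in> insert y H" for h
    using smult_in_span_over[OF R.one_closed that subset_refl ins] ins that by auto
  have "submodule ?K R M" by (rule span_over_submodule[OF R.oneideal ins])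
  moreover have "H \<subset> ?K" using gen notin y_def by auto
  moreover have "?K \<subseteq> H'"
  proof
    fix z assume "z \<in> ?K"
    then show "z \<in> H'"
      by (rule span_over_subset[OF _ H'(1)]) (use submoduleE(4)[OF H'(1)] yH' H'(2) in auto)
  qed
  ultimately have "?K = H'" using max by blast
  then have "x \<in> ?K" using x by simp
  then obtain c h where c: "c \<in> carrier R" "h \<in> span_over M (carrier R) H" "x = c \<odot>\<^bsub>M\<^esub> y \<oplus>\<^bsub>M\<^esub> h"
    by (rule span_over_insert[OF _ R.oneideal ins])
  have h: "h \<in> H" by (rule span_over_subset[OF c(2) H]) (use submoduleE(4)[OF H] in auto)
  then have hc: "h \<in> carrier M" using Hc by auto
  define s where "s = \<one> \<ominus> c \<otimes> a"
  have "s \<in> carrier R - m"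
    unfolding s_def using a c m.I_notcarr m.one_imp_carrier
    by (intro m.nonmember_minus) (auto intro: m.I_l_closed)
  then have s: "s \<in> Units R" by (rule noeth_local_ring_unit[OF loc])
  have cy: "c \<odot>\<^bsub>M\<^esub> y \<in> carrier M" using c yc by simp
  have "s \<odot>\<^bsub>M\<^esub> x = x \<oplus>\<^bsub>M\<^esub> \<ominus>\<^bsub>M\<^esub> (c \<odot>\<^bsub>M\<^esub> y)"
    using c aR xc by (simp add: s_def y_def R.minus_eq smult_l_distr smult_l_minus smult_assoc1)
  also have "\<dots> = h \<oplus>\<^bsub>M\<^esub> c \<odot>\<^bsub>M\<^esub> y \<oplus>\<^bsub>M\<^esub> \<ominus>\<^bsub>M\<^esub> (c \<odot>\<^bsub>M\<^esub> y)"
    using c(3) M.a_comm[OF cy hc] by simp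
  also have "\<dots> = h" using cy hc by (simp add: M.a_assoc M.r_neg)
  finally have "inv\<^bsub>R\<^esub> s \<odot>\<^bsub>M\<^esub> (s \<odot>\<^bsub>M\<^esub> x) \<in> H"
    using submoduleE(4)[OF H] h s by simp
  then have "x \<in> H" using smult_inv_cancel[OF s xc] by simp
  then show False using notin submoduleE(4)[OF H aR] by blast
qed

end

text \<open>One spot of the resolution tensored with the module: \<open>A\<close> is the p by q
  matrix of the differential leaving the spot and \<open>B\<close> the q by r matrix of the one
  entering it. The assumption \<open>exact\<close> is vanishing homology with coefficients in
  \<open>M\<close> modulo \<open>N\<close>, which is how the vanishing of Tor enters.\<close>

locale exact_mod_submodule = lmodule R M for R :: "('a, 'b) ring_scheme" (structure)
    and M :: "('a, 'm) module" (structure) +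
  fixes A B :: "nat \<Rightarrow> nat \<Rightarrow> 'a" and p q r :: nat and N :: "'m set" and m :: "'a set"
  assumes loc: "noeth_local_ring R m"
    and N: "submodule N R M"
    and A: "\<And>i j. i < p \<Longrightarrow> j < q \<Longrightarrow> A i j \<in> m"
    and B: "\<And>j k. j < q \<Longrightarrow> k < r \<Longrightarrow> B j k \<in> carrier R"
    and AB: "\<And>i k. i < p \<Longrightarrow> k < r \<Longrightarrow> lin_comb (ring_module R) (A i) (\<lambda>j. B j k) q = \<zero>"
    and exact: "\<And>y. y \<in> tuples (carrier M) q \<Longrightarrow> (\<And>i. i < p \<Longrightarrow> lin_comb M (A i) y q \<in> N) \<Longrightarrow>
      \<exists>z \<in> tuples (carrier M) r. \<forall>j<q. y j \<ominus>\<^bsub>M\<^esub> lin_comb M (B j) z r \<in> N"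
begin

sublocale m: primeideal m R
  using loc R.maximalideal_prime by (auto simp: noeth_local_ring_def)

lemma N_carrier: "x \<in> N \<Longrightarrow> x \<in> carrier M"
  using submoduleE(1)[OF N] by auto

lemma A_tuples: "i < p \<Longrightarrow> A i \<in> tuples (carrier R) q"
  using A m.a_subset by (auto simp: tuples_def)

lemma B_tuples: "j < q \<Longrightarrow> B j \<in> tuples (carrier R) r"
  using B by (auto simp: tuples_def)

lemma A_B_zero:
  assumes "i < p" "z \<in> tuples (carrier M) r"
  shows "lin_comb M (A i) (\<lambda>j. lin_comb M (B j) z r) q = \<zero>\<^bsub>M\<^esub>"
proof -
  have "lin_comb M (A i) (\<lambda>j. lin_comb M (B j) z r) q
      = lin_comb M (\<lambda>k. lin_comb (ring_module R) (A i) (\<lambda>j. B j k) q) z r"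
    using assms A_tuples B_tuples by (intro lin_comb_assoc)
  also have "\<dots> = lin_comb M (\<lambda>k. \<zero>) z r"
    using assms AB by (intro lin_comb_cong) (auto intro!: tuplesI)
  also have "\<dots> = \<zero>\<^bsub>M\<^esub>" using assms by (intro lin_comb_zero_left)
  finally show ?thesis .
qed

text \<open>The vector with \<open>w\<close> in position \<open>l\<close> and zero elsewhere is a
  cycle modulo \<open>N\<close>, hence a boundary plus a vector over \<open>N\<close>. Applying
  \<open>A\<close> kills the boundary, so only the part over \<open>N\<close> remains.\<close>

lemma column_in_image:
  assumes w: "w \<in> carrier M" "l < q" "\<And>i. i < p \<Longrightarrow> A i l \<odot>\<^bsub>M\<^esub> w \<in> N"
  shows "\<exists>\<nu> \<in> tuples N q. \<forall>i<p. A i l \<odot>\<^bsub>M\<^esub> w = lin_comb M (A i) \<nu> q"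
proof -
  define y where "y = (\<lambda>j. if j = l then w else \<zero>\<^bsub>M\<^esub>)"
  have y: "y \<in> tuples (carrier M) q" using w by (auto simp: y_def tuples_def)
  have Ay: "lin_comb M (A i) y q = A i l \<odot>\<^bsub>M\<^esub> w" if "i < p" for i
    unfolding y_def using w that A_tuples by (intro lin_comb_unit_right)
  obtain z where z: "z \<in> tuples (carrier M) r" "\<forall>j<q. y j \<ominus>\<^bsub>M\<^esub> lin_comb M (B j) z r \<in> N"
    using exact[OF y] Ay w by auto
  have Bz: "(\<lambda>j. lin_comb M (B j) z r) \<in> tuples (carrier M) q"
    using z B_tuples by (auto intro!: tuplesI)
  show ?thesis
  proof (intro bexI allI impI)
    show "(\<lambda>j. y j \<ominus>\<^bsub>M\<^esub> lin_comb M (B j) z r) \<in> tuples N q"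
      using z by (auto simp: tuples_def)
    fix i assume i: "i < p"
    have "lin_comb M (A i) (\<lambda>j. y j \<ominus>\<^bsub>M\<^esub> lin_comb M (B j) z r) q
        = lin_comb M (A i) y q \<ominus>\<^bsub>M\<^esub> lin_comb M (A i) (\<lambda>j. lin_comb M (B j) z r) q"
      by (rule lin_comb_minus_right[OF A_tuples[OF i] y Bz])
    also have "\<dots> = A i l \<odot>\<^bsub>M\<^esub> w"
      using A_B_zero[OF i z(1)] Ay[OF i] w A_tuples[OF i] by (simp add: M.minus_eq tuplesD)
    finally show "A i l \<odot>\<^bsub>M\<^esub> w = lin_comb M (A i) (\<lambda>j. y j \<ominus>\<^bsub>M\<^esub> lin_comb M (B j) z r) q"
      by (rule sym)
  qed
qed

text \<open>Climbing a composition series of \<open>X/(N :\<^sub>X J)\<close>: multiplying by the maximal ideal moves one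
  step down, where exactness turns membership in \<open>N\<close> into membership in \<open>mN\<close>, and the
  hypothesis on colons removes the factor again.\<close>

lemma entries_into_colon:
  assumes J: "ideal J R"
    and fin_len: "quotient_finite_length R M (colon_sub R M N J)"
    and colon_eq: "colon_sub R M N J
      = colon_sub R M (ideal_smult R M m N) (ideal_prod_set R m J)"
    and x: "x \<in> carrier M" and ij: "i < p" "j < q"
  shows "A i j \<odot>\<^bsub>M\<^esub> x \<in> colon_sub R M N J"
proof -
  interpret J: ideal J R by fact
  obtain n ch where ch: "ch 0 = colon_sub R M N J" "ch n = carrier M"
    "\<And>k. k \<le> n \<Longrightarrow> submodule (ch k) R M" "\<And>k. k < n \<Longrightarrow> ch k \<subset> ch (Suc k)"
    "\<And>k. k < n \<Longrightarrow> \<not> (\<exists>K. submodule K R M \<and> ch k \<subset> K \<and> K \<subset> ch (Suc k))"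
    using fin_len unfolding quotient_finite_length_def by auto
  have mN: "ideal_smult R M m N = span_over M m N"
    using m.a_subset N_carrier by (intro ideal_smult_eq_span_over) auto
  have mN_sub: "submodule (span_over M m N) R M"
    using N_carrier by (intro span_over_submodule m.ideal_axioms) auto
  \<comment> \<open>The induction covers all rows at once, since \<open>column_in_image\<close>
    needs a whole column of values in \<open>N\<close>. It starts trivially because the colon is a
    submodule.\<close>
  have "\<forall>x \<in> ch k. \<forall>i<p. \<forall>j<q. A i j \<odot>\<^bsub>M\<^esub> x \<in> colon_sub R M N J" if "k \<le> n" for k
    using that
  proof (induction k)
    case 0
    have "submodule (colon_sub R M N J) R M" using ch(1) ch(3)[of 0] by simp
    then show ?case using ch(1) A m.a_subset by (auto intro: submoduleE(4))
  next
    case (Suc k)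
    show ?case
    proof (intro ballI allI impI)
      fix x i j assume x: "x \<in> ch (Suc k)" and i: "i < p" and j: "j < q"
      have xc: "x \<in> carrier M" using submoduleE(1)[OF ch(3)[OF Suc.prems]] x by auto
      have Ac: "A i' j \<in> carrier R" if "i' < p" for i' using A[OF that j] m.a_subset by auto
      have "A i j \<odot>\<^bsub>M\<^esub> x \<in> carrier M" using xc Ac[OF i] by simp
      moreover have "r \<odot>\<^bsub>M\<^esub> (A i j \<odot>\<^bsub>M\<^esub> x) \<in> span_over M m N"
        if r: "r \<in> ideal_prod_set R m J" for r
      proof (rule ideal_prod_smult_in_submodule[OF mN_sub _ m.a_subset J.a_subset _ r])
        show "A i j \<odot>\<^bsub>M\<^esub> x \<in> carrier M" using xc Ac[OF i] by simp
        fix a c assume a: "a \<in> m" and c: "c \<in> J"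
        have ac: "a \<in> carrier R" "c \<in> carrier R" using a c m.a_subset J.a_subset by auto
        \<comment> \<open>The scalars are reordered so that \<open>a\<close> acts on
          \<open>x\<close> first, where it moves down the series, and \<open>c\<close> acts last,
          where it turns membership in the colon into membership in \<open>N\<close>.\<close>
        have comm: "a \<odot>\<^bsub>M\<^esub> (c \<odot>\<^bsub>M\<^esub> (A i' j \<odot>\<^bsub>M\<^esub> x)) = A i' j \<odot>\<^bsub>M\<^esub> (c \<odot>\<^bsub>M\<^esub> (a \<odot>\<^bsub>M\<^esub> x))"
          "c \<odot>\<^bsub>M\<^esub> (A i' j \<odot>\<^bsub>M\<^esub> (a \<odot>\<^bsub>M\<^esub> x)) = A i' j \<odot>\<^bsub>M\<^esub> (c \<odot>\<^bsub>M\<^esub> (a \<odot>\<^bsub>M\<^esub> x))" if "i' < p" for i'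
          using ac Ac[OF that] xc by (simp_all add: smult_left_comm)
        have "a \<odot>\<^bsub>M\<^esub> x \<in> ch k"
          using Suc.prems x a ch
          by (intro simple_quotient_annihilated[OF loc, of "ch k" "ch (Suc k)"]) auto
        then have "A i' j \<odot>\<^bsub>M\<^esub> (a \<odot>\<^bsub>M\<^esub> x) \<in> colon_sub R M N J" if "i' < p" for i'
          using Suc.IH Suc.prems that j by auto
        then have N: "A i' j \<odot>\<^bsub>M\<^esub> (c \<odot>\<^bsub>M\<^esub> (a \<odot>\<^bsub>M\<^esub> x)) \<in> N" if "i' < p" for i'
          using that c unfolding comm(2)[OF that, symmetric] by (simp add: colon_sub_def)
        have "c \<odot>\<^bsub>M\<^esub> (a \<odot>\<^bsub>M\<^esub> x) \<in> carrier M" using ac xc by simp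
        from column_in_image[OF this j N] obtain \<nu> where \<nu>: "\<nu> \<in> tuples N q"
          "\<And>i'. i' < p \<Longrightarrow> A i' j \<odot>\<^bsub>M\<^esub> (c \<odot>\<^bsub>M\<^esub> (a \<odot>\<^bsub>M\<^esub> x)) = lin_comb M (A i') \<nu> q"
          by blast
        \<comment> \<open>Minimality enters here: the entries of \<open>A\<close> lie in
          \<open>m\<close>, so a vector over \<open>N\<close> is sent into mN.\<close>
        have "lin_comb M (A i) \<nu> q \<in> span_over M m N"
          using \<nu>(1) A[OF i] m.a_subset N_carrier
          by (intro lin_comb_in_span_over) (auto simp: tuples_def)
        then show "a \<odot>\<^bsub>M\<^esub> (c \<odot>\<^bsub>M\<^esub> (A i j \<odot>\<^bsub>M\<^esub> x)) \<in> span_over M m N"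
          using comm(1)[OF i] \<nu>(2)[OF i] by simp
      qed
      ultimately show "A i j \<odot>\<^bsub>M\<^esub> x \<in> colon_sub R M N J"
        unfolding colon_eq mN by (simp add: colon_sub_def)
    qed
  qed
  then show ?thesis using ch(2) x ij by blast
qed

text \<open>Nakayama for the module spanned by the products of the entries of row \<open>i\<close>
  with generators of JX. By \<open>column_in_image\<close> each such product comes from a vector
  over \<open>N\<close>, and \<open>N\<close> lies in mJX, so the product is a combination of the
  same products with coefficients in \<open>m\<close>.\<close>

lemma entries_annihilate:
  assumes fg: "finitely_generated R M" and J: "ideal J R"
    and N_sub: "N \<subseteq> ideal_smult R M (ideal_prod_set R m J) (carrier M)"
    and colon: "\<And>x i j. x \<in> carrier M \<Longrightarrow> i < p \<Longrightarrow> j < q \<Longrightarrow> A i j \<odot>\<^bsub>M\<^esub> x \<in> colon_sub R M N J"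
    and ij: "i < p" "j < q" and y: "y \<in> ideal_smult R M J (carrier M)"
  shows "A i j \<odot>\<^bsub>M\<^esub> y = \<zero>\<^bsub>M\<^esub>"
proof -
  interpret J: ideal J R by fact
  have noeth: "noetherian_ring R" using loc by (simp add: noeth_local_ring_def)
  obtain W where W: "finite W" "W \<subseteq> {a \<odot>\<^bsub>M\<^esub> x | a x. a \<in> J \<and> x \<in> carrier M}"
    and gen: "\<And>a x. a \<in> J \<Longrightarrow> x \<in> carrier M \<Longrightarrow> a \<odot>\<^bsub>M\<^esub> x \<in> span_over M (carrier R) W"
    using finite_generators_ideal_smult[OF noeth fg J] by (elim exE conjE) simp
  have Wc: "W \<subseteq> carrier M" using W J.a_subset by auto
  have Ac: "A i j \<in> carrier R" if "j < q" for j using A[OF ij(1) that] m.a_subset by auto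
  have W_sub: "submodule (span_over M m W) R M" by (rule span_over_submodule[OF m.ideal_axioms Wc])
  have prod_carrier: "ideal_prod_set R m J \<subseteq> carrier R"
    unfolding ideal_prod_set_def using m.a_subset J.a_subset
    by (intro additive_subgroup.a_subset[OF ideal.axioms(1)[OF R.genideal_ideal]]) auto
  \<comment> \<open>A product of an element of \<open>m\<close> with one of \<open>J\<close> first
    sends x into the span of \<open>W\<close>, and the factor from \<open>m\<close> then makes the
    coefficients lie in \<open>m\<close>.\<close>
  have N_W: "x \<in> span_over M m W" if "x \<in> N" for x
  proof -
    have "x \<in> span_over M (ideal_prod_set R m J) (carrier M)"
      using that N_sub ideal_smult_eq_span_over[OF prod_carrier subset_refl] by auto
    then show ?thesis
    proof (rule span_over_subset[OF _ W_sub])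
      fix c x assume c: "c \<in> ideal_prod_set R m J" and x: "x \<in> carrier M"
      show "c \<odot>\<^bsub>M\<^esub> x \<in> span_over M m W"
      proof (rule ideal_prod_smult_in_submodule[OF W_sub x m.a_subset J.a_subset _ c])
        show "a \<odot>\<^bsub>M\<^esub> (b \<odot>\<^bsub>M\<^esub> x) \<in> span_over M m W" if "a \<in> m" "b \<in> J" for a b
          by (rule smult_span_over_carrier[OF gen[OF that(2) x] that(1) m.ideal_axioms Wc])
      qed
    qed
  qed
  \<comment> \<open>Row \<open>i\<close> is fixed, but all columns \<open>l\<close> occur: the
    vector over \<open>N\<close> found for one column has entries in every position.\<close>
  define G where "G = (\<lambda>(l, w). A i l \<odot>\<^bsub>M\<^esub> w) ` ({..<q} \<times> W)"
  have Gc: "G \<subseteq> carrier M" using Wc Ac by (auto simp: G_def)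
  have G_sub: "submodule (span_over M m G) R M" by (rule span_over_submodule[OF m.ideal_axioms Gc])
  have A_span: "A i l \<odot>\<^bsub>M\<^esub> u \<in> span_over M m G" if "u \<in> span_over M m W" "l < q" for u l
    using that
  proof induction
    case zero
    then show ?case using Ac by (simp add: span_over.zero)
  next
    case (add c w z)
    have car: "c \<in> carrier R" "w \<in> carrier M" "z \<in> carrier M"
      using add m.a_subset Wc by (auto intro: span_over_closed)
    have "A i l \<odot>\<^bsub>M\<^esub> (c \<odot>\<^bsub>M\<^esub> w \<oplus>\<^bsub>M\<^esub> z) = c \<odot>\<^bsub>M\<^esub> (A i l \<odot>\<^bsub>M\<^esub> w) \<oplus>\<^bsub>M\<^esub> A i l \<odot>\<^bsub>M\<^esub> z"
      using car Ac[OF \<open>l < q\<close>] by (simp add: smult_r_distr smult_left_comm)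
    also have "\<dots> \<in> span_over M m G"
      by (rule span_over.add[OF add.hyps(1) _ add.IH[OF \<open>l < q\<close>]]) (use add in \<open>auto simp: G_def\<close>)
    finally show ?case .
  qed
  have "\<exists>s \<in> carrier R - m. \<forall>g \<in> G. s \<odot>\<^bsub>M\<^esub> g = \<zero>\<^bsub>M\<^esub>"
  proof (rule nakayama_at_prime[OF m.primeideal _ Gc])
    show "finite G" using W by (simp add: G_def)
    \<comment> \<open>Here the prime is \<open>m\<close> itself and no denominator is required, so
      Nakayama is started with 1.\<close>
    show "\<one> \<in> carrier R - m" using m.I_notcarr m.one_imp_carrier by auto
    fix g assume g: "g \<in> G"
    then obtain l w where lw: "l < q" "w \<in> W" "g = A i l \<odot>\<^bsub>M\<^esub> w" by (auto simp: G_def)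
    then obtain a x where ax: "a \<in> J" "x \<in> carrier M" "w = a \<odot>\<^bsub>M\<^esub> x" using W by blast
    have AwN: "A i' l \<odot>\<^bsub>M\<^esub> w \<in> N" if "i' < p" for i'
    proof -
      have "a \<odot>\<^bsub>M\<^esub> (A i' l \<odot>\<^bsub>M\<^esub> x) \<in> N"
        using colon[OF ax(2) that lw(1)] ax(1) by (simp add: colon_sub_def)
      moreover have "A i' l \<in> carrier R" "a \<in> carrier R"
        using A[OF that lw(1)] m.a_subset ax(1) J.a_subset by auto
      ultimately show ?thesis using ax by (simp add: smult_left_comm)
    qed
    have "w \<in> carrier M" using lw Wc by auto
    from column_in_image[OF this lw(1) AwN] obtain \<nu> where \<nu>: "\<nu> \<in> tuples N q"
        "\<And>i'. i' < p \<Longrightarrow> A i' l \<odot>\<^bsub>M\<^esub> w = lin_comb M (A i') \<nu> q"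
      by blast
    have "lin_comb M (A i) \<nu> q \<in> span_over M m G"
      using \<nu>(1) N_W A_span A_tuples[OF ij(1)] N_carrier
      by (intro lin_comb_in_submodule[OF G_sub]) (auto simp: tuples_def)
    then have "g \<in> span_over M m G" using \<nu>(2)[OF ij(1)] lw by simp
    then show "\<one> \<odot>\<^bsub>M\<^esub> g \<in> span_over M m G" using g Gc by auto
  qed
  \<comment> \<open>An element outside \<open>m\<close> is a unit, so being killed by
    \<open>s\<close> means being zero.\<close>
  then obtain s where s: "s \<in> Units R" "\<forall>g \<in> G. s \<odot>\<^bsub>M\<^esub> g = \<zero>\<^bsub>M\<^esub>"
    using noeth_local_ring_unit[OF loc] by blast
  have G0: "g = \<zero>\<^bsub>M\<^esub>" if "g \<in> G" for g
  proof -
    have "inv\<^bsub>R\<^esub> s \<odot>\<^bsub>M\<^esub> (s \<odot>\<^bsub>M\<^esub> g) = g"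
      using s(1) Gc that by (intro smult_inv_cancel) auto
    then show ?thesis using s that by simp
  qed
  have "y \<in> span_over M J (carrier M)"
    using y ideal_smult_eq_span_over[OF J.a_subset subset_refl] by simp
  then have "y \<in> span_over M (carrier R) W"
    by (rule span_over_subset[OF _ span_over_submodule[OF R.oneideal Wc] gen])
  then show ?thesis
    using G0 ij(2) by (rule_tac span_over_annihilated[OF _ subset_refl Wc Ac[OF ij(2)]]) (auto simp: G_def)
qed

end

subsection \<open>Free resolutions\<close>

lemma (in cring) lmodule_ring_module: "lmodule R (ring_module R)"
  by (simp add: lmodule_def module_ring_module)

lemma (in cring) lin_comb_ring_unit_right:
  assumes "i < n" "x \<in> carrier R" "c \<in> tuples (carrier R) n"
  shows "lin_comb (ring_module R) c (\<lambda>j. if j = i then x else \<zero>) n = c i \<otimes> x"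
  using lmodule.lin_comb_unit_right[OF lmodule_ring_module, of i n x c] assms
  by (simp cong: if_cong)

text \<open>Lets the module lemmas on linear combinations be applied to matrix entries that lie in
  an ideal.\<close>

lemma (in ideal) submodule_ring_module:
  assumes "cring R"
  shows "submodule I R (ring_module R)"
proof -
  interpret RM: lmodule R "ring_module R" by (rule cring.lmodule_ring_module[OF assms])
  show ?thesis by (rule RM.submoduleI) (use a_subset in \<open>auto intro: I_l_closed\<close>)
qed

lemma (in abelian_group) eq_if_minus_eq_zero:
  assumes "x \<ominus> y = \<zero>" "x \<in> carrier G" "y \<in> carrier G"
  shows "x = y"
  using minus_equality[of x "\<ominus> y"] assms by (simp add: minus_eq)

lemma bounded_choice:
  assumes "\<forall>i<n::nat. \<exists>c \<in> S. P i c"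
  shows "\<exists>C. \<forall>i<n. C i \<in> S \<and> P i (C i)"
  using assms by (metis (mono_tags))

text \<open>The product of finitely many denominators serves all conditions at once, as each is
  stable under multiples, and primeness keeps the product outside the ideal.\<close>

lemma (in primeideal) common_denominator:
  assumes "\<And>i. i < (n::nat) \<Longrightarrow> \<exists>s \<in> carrier R - I. P i s"
    and "\<And>i s r. i < n \<Longrightarrow> s \<in> carrier R - I \<Longrightarrow> P i s \<Longrightarrow> r \<in> carrier R \<Longrightarrow> P i (r \<otimes> s)"
  shows "\<exists>s \<in> carrier R - I. \<forall>i<n. P i s"
  using assms
proof (induction n)
  case 0
  show ?case using I_notcarr one_imp_carrier by auto
next
  case (Suc n)
  obtain s where s: "s \<in> carrier R - I" "\<forall>i<n. P i s" using Suc by (metis less_SucI)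
  obtain s' where s': "s' \<in> carrier R - I" "P n s'" using Suc.prems(1) by blast
  have "P i (s \<otimes> s')" if "i < Suc n" for i
  proof (cases "i = n")
    case True
    then show ?thesis using Suc.prems(2)[of n s' s] s s' by simp
  next
    case False
    then have "P i (s' \<otimes> s)" using Suc.prems(2)[of i s s'] that s s' by simp
    then show ?thesis using s s' by (simp add: m_comm)
  qed
  then show ?case using nonmember_mult[OF s(1) s'(1)] by blast
qed

locale resolved_module = lmodule R M for R :: "('a, 'b) ring_scheme" (structure)
    and M :: "('a, 'm) module" (structure) +
  fixes b :: "nat \<Rightarrow> nat" and d :: "nat \<Rightarrow> nat \<Rightarrow> nat \<Rightarrow> 'a" and g :: "nat \<Rightarrow> 'm"
  assumes res: "free_resolution R M b d g"
begin

sublocale RM: lmodule R "ring_module R" by (rule R.lmodule_ring_module)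

lemma d_closed: "i < b n \<Longrightarrow> j < b (Suc n) \<Longrightarrow> d (Suc n) i j \<in> carrier R"
  using res unfolding free_resolution_def by (metis diff_Suc_1 le_add1 plus_1_eq_Suc)

lemma d_row: "i < b n \<Longrightarrow> d (Suc n) i \<in> tuples (carrier R) (b (Suc n))"
  and d_column: "j < b (Suc n) \<Longrightarrow> (\<lambda>i. d (Suc n) i j) \<in> tuples (carrier R) (b n)"
  by (auto intro!: tuplesI d_closed)

lemma g_tuples: "g \<in> tuples (carrier M) (b 0)"
  using res unfolding free_resolution_def by blast

lemma generators:
  assumes "x \<in> carrier M"
  shows "\<exists>c \<in> tuples (carrier R) (b 0). x = lin_comb M c g (b 0)"
  using res assms unfolding free_resolution_def by blast

lemma exact_0:
  assumes "c \<in> tuples (carrier R) (b 0)"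
  shows "lin_comb M c g (b 0) = \<zero>\<^bsub>M\<^esub> \<longleftrightarrow>
    (\<exists>z \<in> tuples (carrier R) (b (Suc 0)).
       \<forall>i<b 0. c i = lin_comb (ring_module R) (d (Suc 0) i) z (b (Suc 0)))"
  using res assms unfolding free_resolution_def mat_app_eq One_nat_def by blast

lemma exact_Suc:
  assumes "c \<in> tuples (carrier R) (b (Suc n))"
  shows "(\<forall>i<b n. lin_comb (ring_module R) (d (Suc n) i) c (b (Suc n)) = \<zero>) \<longleftrightarrow>
    (\<exists>z \<in> tuples (carrier R) (b (Suc (Suc n))). \<forall>i<b (Suc n).
       c i = lin_comb (ring_module R) (d (Suc (Suc n)) i) z (b (Suc (Suc n))))"
proof -
  have "\<forall>n\<ge>1. \<forall>c \<in> tuples (carrier R) (b n).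
        (\<forall>i<b (n - 1). lin_comb (ring_module R) (d n i) c (b n) = \<zero>\<^bsub>R\<^esub>) \<longleftrightarrow>
        (\<exists>z \<in> tuples (carrier R) (b (Suc n)).
           \<forall>i<b n. c i = lin_comb (ring_module R) (d (Suc n) i) z (b (Suc n)))"
    using res unfolding free_resolution_def mat_app_eq by blast
  from this[rule_format, of "Suc n", OF _ assms] show ?thesis by simp
qed

text \<open>A column is the image of a standard basis vector. Exactness is stated as an equivalence,
  and its direction from image to kernel, applied to columns, yields d d = 0.\<close>

lemma column_in_image:
  assumes "k < b (Suc n)"
  shows "\<exists>z \<in> tuples (carrier R) (b (Suc n)).
    \<forall>i<b n. d (Suc n) i k = lin_comb (ring_module R) (d (Suc n) i) z (b (Suc n))"
proof (intro bexI allI impI)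
  let ?z = "\<lambda>j. if j = k then \<one> else \<zero>"
  show "?z \<in> tuples (carrier R) (b (Suc n))" by (auto intro: tuplesI)
  fix i assume i: "i < b n"
  show "d (Suc n) i k = lin_comb (ring_module R) (d (Suc n) i) ?z (b (Suc n))"
    using R.lin_comb_ring_unit_right[OF assms _ d_row[OF i], of \<one>] d_closed[OF i assms] by simp
qed

lemma comp_0:
  assumes "k < b (Suc 0)"
  shows "lin_comb M (\<lambda>i. d (Suc 0) i k) g (b 0) = \<zero>\<^bsub>M\<^esub>"
  using exact_0[OF d_column[OF assms]] column_in_image[OF assms] by simp

lemma comp_Suc:
  assumes "i < b n" "k < b (Suc (Suc n))"
  shows "lin_comb (ring_module R) (d (Suc n) i) (\<lambda>j. d (Suc (Suc n)) j k) (b (Suc n)) = \<zero>"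
  using exact_Suc[OF d_column[OF assms(2)]] column_in_image[OF assms(2)] assms(1) by simp

text \<open>The matrices \<open>Z\<close> and \<open>U\<close> play the role of a contracting homotopy \<open>s - U = dZ\<close>; applying it
  to the columns of \<open>d\<close> shows \<open>d Z d = s d\<close> up to the denominator that kills \<open>U d\<close>.\<close>

lemma splitting_step:
  assumes sp: "primeideal p R" "s \<in> carrier R - p" "s' \<in> carrier R - p"
    and U: "\<And>i q. i < b n \<Longrightarrow> q < b n \<Longrightarrow> U i q \<in> carrier R"
    and Z: "\<forall>i<b n. \<exists>z \<in> tuples (carrier R) (b (Suc n)). \<forall>q<b n.
      (if q = i then s else \<zero>) \<ominus> U i q = lin_comb (ring_module R) (d (Suc n) q) z (b (Suc n))"
    and dU: "\<And>l q. l < b (Suc n) \<Longrightarrow> q < b n \<Longrightarrow>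
      s' \<otimes> lin_comb (ring_module R) (\<lambda>i. d (Suc n) i l) (\<lambda>i. U i q) (b n) = \<zero>"
  shows "\<exists>s \<in> carrier R - p. \<exists>Z. (\<forall>i<b n. Z i \<in> tuples (carrier R) (b (Suc n))) \<and>
    (\<forall>q<b n. \<forall>l<b (Suc n). s \<otimes> d (Suc n) q l =
       lin_comb (ring_module R) (\<lambda>i. d (Suc n) i l)
         (\<lambda>i. lin_comb (ring_module R) (d (Suc n) q) (Z i) (b (Suc n))) (b n))"
proof -
  interpret p: primeideal p R by fact
  from bounded_choice[OF Z] obtain Z where Z': "\<forall>i<b n. Z i \<in> tuples (carrier R) (b (Suc n)) \<and>
      (\<forall>q<b n. (if q = i then s else \<zero>) \<ominus> U i q =
        lin_comb (ring_module R) (d (Suc n) q) (Z i) (b (Suc n)))" ..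
  have Z: "Z i \<in> tuples (carrier R) (b (Suc n))"
    "q < b n \<Longrightarrow> (if q = i then s else \<zero>) \<ominus> U i q =
        lin_comb (ring_module R) (d (Suc n) q) (Z i) (b (Suc n))" if "i < b n" for i q
    using Z'[rule_format, OF that] by simp_all
  have s: "s \<in> carrier R" "s' \<in> carrier R" using sp by auto
  \<comment> \<open>The homotopy is rescaled by \<open>s'\<close> so that the error term
    \<open>U\<close> disappears after composition with the differential. Row \<open>i\<close> of
    \<open>Z\<close> is the image of the i-th basis vector.\<close>
  let ?Z = "\<lambda>i r. s' \<otimes> Z i r"
  have "(s' \<otimes> s) \<otimes> d (Suc n) q l =
       lin_comb (ring_module R) (\<lambda>i. d (Suc n) i l)
         (\<lambda>i. lin_comb (ring_module R) (d (Suc n) q) (?Z i) (b (Suc n))) (b n)"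
    if q: "q < b n" and l: "l < b (Suc n)" for q l
  proof -
    let ?col = "\<lambda>i. d (Suc n) i l"
    note col = d_column[OF l]
    have Uq: "(\<lambda>i. U i q) \<in> tuples (carrier R) (b n)" using U q by (auto intro: tuplesI)
    have sq: "(\<lambda>i. if i = q then s else \<zero>) \<in> tuples (carrier R) (b n)"
      using s by (auto intro: tuplesI)
    have diff: "(\<lambda>i. (if i = q then s else \<zero>) \<ominus> U i q) \<in> tuples (carrier R) (b n)"
      using Uq sq by (auto simp: tuples_def)
    have inner: "lin_comb (ring_module R) (d (Suc n) q) (?Z i) (b (Suc n))
        = s' \<otimes> ((if i = q then s else \<zero>) \<ominus> U i q)" if "i < b n" for i
    proof -
      have "(if i = q then s else \<zero>) \<ominus> U i q = lin_comb (ring_module R) (d (Suc n) q) (Z i) (b (Suc n))"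
        using Z(2)[OF that q] by (simp only: eq_commute[of q i])
      then show ?thesis
        using RM.lin_comb_smult_right[OF d_row[OF q], of "Z i" s'] Z(1)[OF that] s by simp
    qed
    have "lin_comb (ring_module R) ?col
         (\<lambda>i. lin_comb (ring_module R) (d (Suc n) q) (?Z i) (b (Suc n))) (b n)
       = lin_comb (ring_module R) ?col (\<lambda>i. s' \<otimes> ((if i = q then s else \<zero>) \<ominus> U i q)) (b n)"
      by (rule RM.lin_comb_cong[symmetric]) (use col inner diff s in \<open>auto simp: tuples_def\<close>)
    also have "\<dots> = s' \<otimes> lin_comb (ring_module R) ?col (\<lambda>i. (if i = q then s else \<zero>) \<ominus> U i q) (b n)"
      using RM.lin_comb_smult_right[OF col, of _ s'] diff s by simp
    also have "lin_comb (ring_module R) ?col (\<lambda>i. (if i = q then s else \<zero>) \<ominus> U i q) (b n)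
       = lin_comb (ring_module R) ?col (\<lambda>i. if i = q then s else \<zero>) (b n)
         \<ominus> lin_comb (ring_module R) ?col (\<lambda>i. U i q) (b n)"
      using RM.lin_comb_minus_right[OF col, of "\<lambda>i. if i = q then s else \<zero>" "\<lambda>i. U i q"] sq Uq by simp
    also have "lin_comb (ring_module R) ?col (\<lambda>i. if i = q then s else \<zero>) (b n) = d (Suc n) q l \<otimes> s"
      using R.lin_comb_ring_unit_right[OF q _ col, of s] s by simp
    \<comment> \<open>This is where the denominator \<open>s'\<close> removes the
      \<open>U\<close>-term, by \<open>dU\<close>.\<close>
    also have "s' \<otimes> (d (Suc n) q l \<otimes> s \<ominus> lin_comb (ring_module R) ?col (\<lambda>i. U i q) (b n))
        = s' \<otimes> (d (Suc n) q l \<otimes> s)"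
    proof -
      have "lin_comb (ring_module R) ?col (\<lambda>i. U i q) (b n) \<in> carrier R"
        using RM.lin_comb_closed[OF col] Uq by simp
      then show ?thesis
        using dU[OF l q] s d_closed[OF q l] by (simp add: R.minus_eq R.r_distr R.r_minus)
    qed
    also have "\<dots> = (s' \<otimes> s) \<otimes> d (Suc n) q l"
      using s d_closed[OF q l] by (simp add: R.m_ac)
    finally show ?thesis by (rule sym)
  qed
  moreover have "\<forall>i<b n. ?Z i \<in> tuples (carrier R) (b (Suc n))"
    using Z(1) s by (auto simp: tuples_def)
  ultimately show ?thesis
    using p.nonmember_mult[OF sp(3,2)] by (intro bexI[of _ "s' \<otimes> s"] exI[of _ ?Z]) simp_all
qed

text \<open>Up to a denominator s outside \<open>p\<close>, each differential satisfies s d = d h d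
  with h given by \<open>Z\<close>. The first h comes from lifting a local basis of the module; then
  s - h d is killed by d, so exactness lifts it to the next h.\<close>

lemma locally_split:
  assumes p: "primeideal p R" and free: "locally_free_at R M p"
  shows "\<exists>s \<in> carrier R - p. \<exists>Z. (\<forall>i<b n. Z i \<in> tuples (carrier R) (b (Suc n))) \<and>
    (\<forall>q<b n. \<forall>l<b (Suc n). s \<otimes> d (Suc n) q l =
       lin_comb (ring_module R) (\<lambda>i. d (Suc n) i l)
         (\<lambda>i. lin_comb (ring_module R) (d (Suc n) q) (Z i) (b (Suc n))) (b n))"
proof (induction n)
  case 0
  interpret p: primeideal p R by fact
  obtain k e where e: "e \<in> tuples (carrier M) k"
    and gen: "\<And>x. x \<in> carrier M \<Longrightarrow> \<exists>s \<in> carrier R - p. \<exists>c \<in> tuples (carrier R) k.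
        s \<odot>\<^bsub>M\<^esub> x = lin_comb M c e k"
    and indep: "\<And>c. c \<in> tuples (carrier R) k \<Longrightarrow> lin_comb M c e k = \<zero>\<^bsub>M\<^esub> \<Longrightarrow>
        \<forall>j<k. \<exists>s \<in> carrier R - p. s \<otimes> c j = \<zero>"
  proof -
    from free obtain k e where "e \<in> tuples (carrier M) k"
      and 1: "\<forall>x \<in> carrier M. \<exists>s \<in> carrier R - p. \<exists>c \<in> tuples (carrier R) k.
        s \<odot>\<^bsub>M\<^esub> x = lin_comb M c e k"
      and 2: "\<forall>c \<in> tuples (carrier R) k.
        (\<exists>s \<in> carrier R - p. s \<odot>\<^bsub>M\<^esub> lin_comb M c e k = \<zero>\<^bsub>M\<^esub>) \<longrightarrow>
        (\<forall>j<k. \<exists>s \<in> carrier R - p. s \<otimes>\<^bsub>R\<^esub> c j = \<zero>\<^bsub>R\<^esub>)"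
      unfolding locally_free_at_def by blast
    \<comment> \<open>Only relations holding on the nose occur below, so local independence is
      specialized to denominator 1.\<close>
    moreover have "\<one> \<in> carrier R - p" using p.I_notcarr p.one_imp_carrier by auto
    then have "\<forall>j<k. \<exists>s \<in> carrier R - p. s \<otimes> c j = \<zero>"
      if "c \<in> tuples (carrier R) k" "lin_comb M c e k = \<zero>\<^bsub>M\<^esub>" for c
      using 2 that smult_r_null[OF R.one_closed] by metis
    ultimately show thesis using that[of e k] by blast
  qed
  have "\<exists>s \<in> carrier R - p. \<forall>i<b 0. \<exists>c \<in> tuples (carrier R) k. s \<odot>\<^bsub>M\<^esub> g i = lin_comb M c e k"
  proof (rule p.common_denominator)
    show "\<exists>s \<in> carrier R - p. \<exists>c \<in> tuples (carrier R) k. s \<odot>\<^bsub>M\<^esub> g i = lin_comb M c e k"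
      if "i < b 0" for i using gen tuplesD[OF g_tuples that] by blast
    fix i s r assume i: "i < b 0" and s: "s \<in> carrier R - p" and r: "r \<in> carrier R"
      and "\<exists>c \<in> tuples (carrier R) k. s \<odot>\<^bsub>M\<^esub> g i = lin_comb M c e k"
    then obtain c where c: "c \<in> tuples (carrier R) k" "s \<odot>\<^bsub>M\<^esub> g i = lin_comb M c e k" by blast
    have "(r \<otimes> s) \<odot>\<^bsub>M\<^esub> g i = lin_comb M (\<lambda>j. r \<otimes> c j) e k"
      using lin_comb_smult_left[OF c(1) e r] c(2) s r tuplesD[OF g_tuples i] by (simp add: smult_assoc1)
    moreover have "(\<lambda>j. r \<otimes> c j) \<in> tuples (carrier R) k" using c r by (auto simp: tuples_def)
    ultimately show "\<exists>c \<in> tuples (carrier R) k. (r \<otimes> s) \<odot>\<^bsub>M\<^esub> g i = lin_comb M c e k" by blast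
  qed
  then obtain s where s: "s \<in> carrier R - p"
    and sg: "\<forall>i<b 0. \<exists>c \<in> tuples (carrier R) k. s \<odot>\<^bsub>M\<^esub> g i = lin_comb M c e k"
    by blast
  from bounded_choice[OF sg] obtain C where
    C': "\<forall>i<b 0. C i \<in> tuples (carrier R) k \<and> s \<odot>\<^bsub>M\<^esub> g i = lin_comb M (C i) e k" ..
  have C: "C i \<in> tuples (carrier R) k" "s \<odot>\<^bsub>M\<^esub> g i = lin_comb M (C i) e k" if "i < b 0" for i
    using C'[rule_format, OF that] by simp_all
  have sR: "s \<in> carrier R" using s by auto
  have "\<forall>j<k. \<exists>c \<in> tuples (carrier R) (b 0). e j = lin_comb M c g (b 0)"
    using generators tuplesD[OF e] by simp
  from bounded_choice[OF this] obtain E where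
    E': "\<forall>j<k. E j \<in> tuples (carrier R) (b 0) \<and> e j = lin_comb M (E j) g (b 0)" ..
  have E: "E j \<in> tuples (carrier R) (b 0)" "e j = lin_comb M (E j) g (b 0)" if "j < k" for j
    using E'[rule_format, OF that] by simp_all
  \<comment> \<open>\<open>U\<close> is the composite of the first free module to R^k by
    \<open>C\<close> and back by \<open>E\<close>. It lifts multiplication by \<open>s\<close> on
    the module, so \<open>s\<close> minus \<open>U\<close> lands in the kernel of the
    augmentation.\<close>
  define U where "U i = (\<lambda>q. lin_comb (ring_module R) (C i) (\<lambda>j. E j q) k)" for i
  have Eq: "(\<lambda>j. E j q) \<in> tuples (carrier R) k" if "q < b 0" for q
    using E that by (auto simp: tuples_def)
  have U: "U i q \<in> carrier R" if "i < b 0" "q < b 0" for i q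
    using RM.lin_comb_closed[OF C(1)[OF that(1)]] Eq[OF that(2)] by (simp add: U_def)
  have lift: "\<exists>z \<in> tuples (carrier R) (b (Suc 0)). \<forall>q<b 0.
      (if q = i then s else \<zero>) \<ominus> U i q = lin_comb (ring_module R) (d (Suc 0) q) z (b (Suc 0))"
    if i: "i < b 0" for i
  proof -
    have sd: "(\<lambda>q. if q = i then s else \<zero>) \<in> tuples (carrier R) (b 0)"
      using sR by (auto intro: tuplesI)
    have Ui: "U i \<in> tuples (carrier R) (b 0)" using U i by (auto intro: tuplesI)
    have "lin_comb M (\<lambda>q. (if q = i then s else \<zero>) \<ominus> U i q) g (b 0)
        = s \<odot>\<^bsub>M\<^esub> g i \<ominus>\<^bsub>M\<^esub> lin_comb M (U i) g (b 0)"
      using lin_comb_minus_left[OF sd Ui g_tuples] lin_comb_unit[OF i sR g_tuples] by simp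
    also have "lin_comb M (U i) g (b 0) = lin_comb M (C i) (\<lambda>j. lin_comb M (E j) g (b 0)) k"
      unfolding U_def by (rule lin_comb_assoc[symmetric, OF C(1)[OF i] E(1) g_tuples])
    also have "\<dots> = lin_comb M (C i) e k"
      by (rule lin_comb_cong[symmetric]) (use C(1)[OF i] e E in auto)
    also have "s \<odot>\<^bsub>M\<^esub> g i \<ominus>\<^bsub>M\<^esub> lin_comb M (C i) e k = \<zero>\<^bsub>M\<^esub>"
      using C(2)[OF i] lin_comb_closed[OF C(1)[OF i] e] by (simp add: M.minus_eq M.r_neg)
    finally have "lin_comb M (\<lambda>q. (if q = i then s else \<zero>) \<ominus> U i q) g (b 0) = \<zero>\<^bsub>M\<^esub>" .
    moreover have "(\<lambda>q. (if q = i then s else \<zero>) \<ominus> U i q) \<in> tuples (carrier R) (b 0)"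
      using sd Ui by (auto simp: tuples_def)
    ultimately show ?thesis using exact_0 by blast
  qed
  \<comment> \<open>The row \<open>dC l\<close> holds the coordinates, in the local basis
    \<open>e\<close>, of \<open>s\<close> times the image of column \<open>l\<close> in the module.
    That image is zero, so local independence kills the coordinates.\<close>
  define dC where
    "dC l = (\<lambda>j. lin_comb (ring_module R) (\<lambda>i. d (Suc 0) i l) (\<lambda>i. C i j) (b 0))" for l
  have Cj: "(\<lambda>i. C i j) \<in> tuples (carrier R) (b 0)" if "j < k" for j
    using C(1) that by (auto simp: tuples_def)
  have dC: "dC l \<in> tuples (carrier R) k" if "l < b (Suc 0)" for l
    using RM.lin_comb_closed[OF d_column[OF that]] Cj by (auto simp: dC_def intro!: tuplesI)
  have dC_zero: "\<exists>s' \<in> carrier R - p. \<forall>j<k. s' \<otimes> dC l j = \<zero>" if l: "l < b (Suc 0)" for l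
  proof (rule p.common_denominator)
    have "lin_comb M (dC l) e k = lin_comb M (\<lambda>i. d (Suc 0) i l) (\<lambda>i. lin_comb M (C i) e k) (b 0)"
      unfolding dC_def by (rule lin_comb_assoc[symmetric, OF d_column[OF l] C(1) e])
    also have "\<dots> = lin_comb M (\<lambda>i. d (Suc 0) i l) (\<lambda>i. s \<odot>\<^bsub>M\<^esub> g i) (b 0)"
      by (rule lin_comb_cong) (use d_column[OF l] C e in \<open>auto intro!: tuplesI\<close>)
    also have "\<dots> = \<zero>\<^bsub>M\<^esub>"
      using lin_comb_smult_right[OF d_column[OF l] g_tuples sR] comp_0[OF l] sR by simp
    finally have "lin_comb M (dC l) e k = \<zero>\<^bsub>M\<^esub>" .
    from indep[OF dC[OF l] this] show "\<exists>s' \<in> carrier R - p. s' \<otimes> dC l j = \<zero>" if "j < k" for j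
      using that by blast
    show "(r \<otimes> s') \<otimes> dC l j = \<zero>"
      if "j < k" "s' \<in> carrier R - p" "s' \<otimes> dC l j = \<zero>" "r \<in> carrier R" for j s' r
      using that tuplesD[OF dC[OF l]] by (simp add: R.m_assoc)
  qed
  have "\<exists>s' \<in> carrier R - p. \<forall>l<b (Suc 0). \<forall>j<k. s' \<otimes> dC l j = \<zero>"
  proof (rule p.common_denominator[OF dC_zero])
    show "\<forall>j<k. (r \<otimes> s') \<otimes> dC l j = \<zero>"
      if "l < b (Suc 0)" "s' \<in> carrier R - p" "\<forall>j<k. s' \<otimes> dC l j = \<zero>" "r \<in> carrier R" for l s' r
      using that tuplesD[OF dC[OF that(1)]] by (simp add: R.m_assoc)
  qed
  then obtain s' where s': "s' \<in> carrier R - p"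
    "\<And>l j. l < b (Suc 0) \<Longrightarrow> j < k \<Longrightarrow> s' \<otimes> dC l j = \<zero>" by blast
  show ?case
  proof (rule splitting_step[where U = U, OF p s s'(1)])
    show "U i q \<in> carrier R" if "i < b 0" "q < b 0" for i q
      using U that by blast
  next
    show "\<forall>i<b 0. \<exists>z \<in> tuples (carrier R) (b (Suc 0)). \<forall>q<b 0.
        (if q = i then s else \<zero>) \<ominus> U i q = lin_comb (ring_module R) (d (Suc 0) q) z (b (Suc 0))"
      using lift by blast
  next
    fix l q assume l: "l < b (Suc 0)" and q: "q < b 0"
    have "lin_comb (ring_module R) (\<lambda>i. d (Suc 0) i l) (\<lambda>i. U i q) (b 0)
        = lin_comb (ring_module R) (dC l) (\<lambda>j. E j q) k"
      unfolding U_def dC_def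
      by (rule RM.lin_comb_assoc) (use d_column[OF l] C(1) Eq[OF q] in auto)
    then have "s' \<otimes> lin_comb (ring_module R) (\<lambda>i. d (Suc 0) i l) (\<lambda>i. U i q) (b 0)
        = lin_comb (ring_module R) (\<lambda>j. s' \<otimes> dC l j) (\<lambda>j. E j q) k"
      using RM.lin_comb_smult_left[OF dC[OF l], of "\<lambda>j. E j q" s'] Eq[OF q] s'(1) by simp
    also have "\<dots> = lin_comb (ring_module R) (\<lambda>j. \<zero>) (\<lambda>j. E j q) k"
      by (rule RM.lin_comb_cong[symmetric]) (use s'(2)[OF l] Eq[OF q] in \<open>auto intro: tuplesI\<close>)
    also have "\<dots> = \<zero>" using RM.lin_comb_zero_left Eq[OF q] by simp
    finally show "s' \<otimes> lin_comb (ring_module R) (\<lambda>i. d (Suc 0) i l) (\<lambda>i. U i q) (b 0) = \<zero>" .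
  qed
next
  case (Suc n)
  interpret p: primeideal p R by fact
  from Suc obtain s Z where s: "s \<in> carrier R - p"
    and Z: "\<And>i. i < b n \<Longrightarrow> Z i \<in> tuples (carrier R) (b (Suc n))"
    and split: "\<And>q l. q < b n \<Longrightarrow> l < b (Suc n) \<Longrightarrow> s \<otimes> d (Suc n) q l =
       lin_comb (ring_module R) (\<lambda>i. d (Suc n) i l)
         (\<lambda>i. lin_comb (ring_module R) (d (Suc n) q) (Z i) (b (Suc n))) (b n)" by blast
  have sR: "s \<in> carrier R" using s by auto
  \<comment> \<open>The second denominator is 1 in this case, because the new \<open>U\<close> is h
    d and (h d) d vanishes exactly.\<close>
  have one: "\<one> \<in> carrier R - p" using p.I_notcarr p.one_imp_carrier by auto
  define U where
    "U j = (\<lambda>i. lin_comb (ring_module R) (\<lambda>l. d (Suc n) l j) (\<lambda>l. Z l i) (b n))" for j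
  have Zi: "(\<lambda>l. Z l i) \<in> tuples (carrier R) (b n)" if "i < b (Suc n)" for i
    using Z that by (auto simp: tuples_def)
  have U: "U j i \<in> carrier R" if "j < b (Suc n)" "i < b (Suc n)" for i j
    using RM.lin_comb_closed[OF d_column[OF that(1)]] Zi[OF that(2)] by (simp add: U_def)
  have lift: "\<exists>z \<in> tuples (carrier R) (b (Suc (Suc n))). \<forall>i<b (Suc n).
      (if i = j then s else \<zero>) \<ominus> U j i = lin_comb (ring_module R) (d (Suc (Suc n)) i) z (b (Suc (Suc n)))"
    if j: "j < b (Suc n)" for j
  proof -
    have sd: "(\<lambda>i. if i = j then s else \<zero>) \<in> tuples (carrier R) (b (Suc n))"
      using sR by (auto intro: tuplesI)
    have Uj: "U j \<in> tuples (carrier R) (b (Suc n))" using U j by (auto intro: tuplesI)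
    have zero: "lin_comb (ring_module R) (d (Suc n) q) (\<lambda>i. (if i = j then s else \<zero>) \<ominus> U j i) (b (Suc n)) = \<zero>"
      if q: "q < b n" for q
    proof -
      have "lin_comb (ring_module R) (d (Suc n) q) (\<lambda>i. (if i = j then s else \<zero>) \<ominus> U j i) (b (Suc n))
          = lin_comb (ring_module R) (d (Suc n) q) (\<lambda>i. if i = j then s else \<zero>) (b (Suc n))
            \<ominus> lin_comb (ring_module R) (d (Suc n) q) (U j) (b (Suc n))"
        using RM.lin_comb_minus_right[OF d_row[OF q], of "\<lambda>i. if i = j then s else \<zero>" "U j"] sd Uj
        by simp
      also have "lin_comb (ring_module R) (d (Suc n) q) (\<lambda>i. if i = j then s else \<zero>) (b (Suc n))
          = s \<otimes> d (Suc n) q j"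
        using R.lin_comb_ring_unit_right[OF j _ d_row[OF q], of s] sR d_closed[OF q j]
        by (simp add: R.m_comm)
      \<comment> \<open>This is d h d = s d from the previous stage; exchanging the sums matches the
        two ways of writing the triple product.\<close>
      also have "lin_comb (ring_module R) (d (Suc n) q) (U j) (b (Suc n)) = s \<otimes> d (Suc n) q j"
        unfolding split[OF q j] U_def using d_row[OF q] d_column[OF j] Z
        by (intro R.lin_comb_swap) (auto simp: tuples_def)
      finally show ?thesis using sR d_closed[OF q j] by (simp add: R.minus_eq R.r_neg)
    qed
    have "(\<lambda>i. (if i = j then s else \<zero>) \<ominus> U j i) \<in> tuples (carrier R) (b (Suc n))"
      using sd Uj by (auto simp: tuples_def)
    from exact_Suc[OF this] zero show ?thesis by blast
  qed
  show ?case
  proof (rule splitting_step[where U = U, OF p s one])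
    show "U j i \<in> carrier R" if "j < b (Suc n)" "i < b (Suc n)" for i j
      using U that by blast
  next
    show "\<forall>j<b (Suc n). \<exists>z \<in> tuples (carrier R) (b (Suc (Suc n))). \<forall>i<b (Suc n).
        (if i = j then s else \<zero>) \<ominus> U j i = lin_comb (ring_module R) (d (Suc (Suc n)) i) z (b (Suc (Suc n)))"
      using lift by blast
  next
    fix k i assume k: "k < b (Suc (Suc n))" and i: "i < b (Suc n)"
    have "lin_comb (ring_module R) (\<lambda>j. d (Suc (Suc n)) j k) (\<lambda>j. U j i) (b (Suc n))
        = lin_comb (ring_module R)
            (\<lambda>l. lin_comb (ring_module R) (\<lambda>j. d (Suc (Suc n)) j k) (\<lambda>j. d (Suc n) l j) (b (Suc n)))
            (\<lambda>l. Z l i) (b n)"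
      unfolding U_def using d_column Zi[OF i] k
      by (intro RM.lin_comb_assoc) auto
    also have "\<dots> = lin_comb (ring_module R) (\<lambda>l. \<zero>) (\<lambda>l. Z l i) (b n)"
    proof (rule RM.lin_comb_cong[symmetric])
      fix l assume l: "l < b n"
      show "\<zero> = lin_comb (ring_module R) (\<lambda>j. d (Suc (Suc n)) j k) (\<lambda>j. d (Suc n) l j) (b (Suc n))"
        using comp_Suc[OF l k] R.lin_comb_commute[OF d_row[OF l] d_column[OF k]] by simp
    qed (use Zi[OF i] in \<open>auto intro: tuplesI\<close>)
    also have "\<dots> = \<zero>" using RM.lin_comb_zero_left Zi[OF i] by simp
    finally show "\<one> \<otimes> lin_comb (ring_module R) (\<lambda>j. d (Suc (Suc n)) j k) (\<lambda>j. U j i) (b (Suc n)) = \<zero>"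
      by simp
  qed
qed

text \<open>In s d = d h d the entries of d h lie in \<open>p\<close>, so \<open>s\<close> times a
  column of d is a combination of that column's entries with coefficients in \<open>p\<close>.
  Nakayama, applied to these entries inside the ring, kills the column at \<open>p\<close>.\<close>

lemma locally_zero:
  assumes p: "primeideal p R" and free: "locally_free_at R M p"
    and entries: "\<And>i j. i < b n \<Longrightarrow> j < b (Suc n) \<Longrightarrow> d (Suc n) i j \<in> p"
    and ij: "i < b n" "j < b (Suc n)"
  shows "\<exists>s \<in> carrier R - p. s \<otimes> d (Suc n) i j = \<zero>"
proof -
  interpret p: primeideal p R by fact
  obtain s Z where s: "s \<in> carrier R - p"
    and Z: "\<And>i. i < b n \<Longrightarrow> Z i \<in> tuples (carrier R) (b (Suc n))"
    and split: "\<And>q l. q < b n \<Longrightarrow> l < b (Suc n) \<Longrightarrow> s \<otimes> d (Suc n) q l =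
       lin_comb (ring_module R) (\<lambda>i. d (Suc n) i l)
         (\<lambda>i. lin_comb (ring_module R) (d (Suc n) q) (Z i) (b (Suc n))) (b n)"
    using locally_split[OF p free, of n] by blast
  define G where "G = (\<lambda>i. d (Suc n) i j) ` {..<b n}"
  have G: "G \<subseteq> carrier (ring_module R)" using d_closed ij by (auto simp: G_def)
  have "\<exists>s \<in> carrier R - p. \<forall>x \<in> G. s \<odot>\<^bsub>ring_module R\<^esub> x = \<zero>\<^bsub>ring_module R\<^esub>"
  proof (rule RM.nakayama_at_prime[OF p _ G s])
    show "finite G" by (simp add: G_def)
    fix x assume "x \<in> G"
    then obtain q where q: "q < b n" "x = d (Suc n) q j" by (auto simp: G_def)
    have coeff: "lin_comb (ring_module R) (d (Suc n) q) (Z i) (b (Suc n)) \<in> p" if i: "i < b n" for i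
      by (rule RM.lin_comb_in_submodule[OF p.submodule_ring_module[OF R.is_cring]])
        (use entries[OF q(1)] Z[OF i] d_row[OF q(1)] in \<open>auto simp: tuples_def intro: p.I_r_closed\<close>)
    have "lin_comb (ring_module R) (\<lambda>i. d (Suc n) i j)
         (\<lambda>i. lin_comb (ring_module R) (d (Suc n) q) (Z i) (b (Suc n))) (b n) \<in> span_over (ring_module R) p G"
    proof (rule RM.lin_comb_in_submodule[OF RM.span_over_submodule[OF p.ideal_axioms G]])
      show "(\<lambda>i. d (Suc n) i j) \<in> tuples (carrier R) (b n)" by (rule d_column[OF ij(2)])
      show "(\<lambda>i. lin_comb (ring_module R) (d (Suc n) q) (Z i) (b (Suc n)))
          \<in> tuples (carrier (ring_module R)) (b n)"
        using coeff p.a_subset by (auto intro!: tuplesI)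
      fix i assume i: "i < b n"
      have "lin_comb (ring_module R) (d (Suc n) q) (Z i) (b (Suc n)) \<odot>\<^bsub>ring_module R\<^esub> d (Suc n) i j
          \<in> span_over (ring_module R) p G"
        by (rule RM.smult_in_span_over[OF coeff[OF i] _ p.a_subset G]) (use i in \<open>simp add: G_def\<close>)
      moreover have "lin_comb (ring_module R) (d (Suc n) q) (Z i) (b (Suc n)) \<in> carrier R"
        using coeff[OF i] p.a_subset by auto
      ultimately show "d (Suc n) i j \<odot>\<^bsub>ring_module R\<^esub>
          lin_comb (ring_module R) (d (Suc n) q) (Z i) (b (Suc n)) \<in> span_over (ring_module R) p G"
        using d_closed[OF i ij(2)] by (simp add: R.m_comm)
    qed
    then show "s \<odot>\<^bsub>ring_module R\<^esub> x \<in> span_over (ring_module R) p G"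
      using split[OF q(1) ij(2)] q(2) by simp
  qed
  then show ?thesis using ij by (auto simp: G_def)
qed

section \<open>Truncation of the resolution and projective dimension\<close>

lemma proj_dim_less_if_rank_zero:
  assumes "b (Suc n) = 0"
  shows "proj_dim_less R M (Suc n)"
proof -
  \<comment> \<open>The matrices are kept and only the ranks beyond \<open>n\<close> are set to
    zero. The new ranks agree with the old ones through \<open>Suc n\<close>, so exactness up to
    degree \<open>n\<close> is inherited.\<close>
  define b' where "b' k = (if k \<le> n then b k else 0)" for k
  have b': "b' k = b k" if "k \<le> Suc n" for k using that assms by (auto simp: b'_def le_Suc_eq)
  have "free_resolution R M b' d g"
    unfolding free_resolution_def mat_app_eq
  proof (intro conjI allI impI ballI)
    show "d k i j \<in> carrier R" if "1 \<le> k" "i < b' (k - 1)" "j < b' k" for k i j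
      using that d_closed[of i "k - 1" j] by (simp add: b'_def split: if_splits)
    show "g \<in> tuples (carrier M) (b' 0)" using g_tuples by (simp add: b'_def)
    show "\<exists>c \<in> tuples (carrier R) (b' 0). x = lin_comb M c g (b' 0)" if "x \<in> carrier M" for x
      using generators[OF that] by (simp add: b'_def)
    show "(lin_comb M c g (b' 0) = \<zero>\<^bsub>M\<^esub>) = (\<exists>z \<in> tuples (carrier R) (b' 1).
        \<forall>i<b' 0. c i = lin_comb (ring_module R) (d 1 i) z (b' 1))"
      if "c \<in> tuples (carrier R) (b' 0)" for c
      using exact_0[of c] that b'[of 0] b'[of 1] by simp
    fix k c assume k: "1 \<le> k" and c: "c \<in> tuples (carrier R) (b' k)"
    show "(\<forall>i<b' (k - 1). lin_comb (ring_module R) (d k i) c (b' k) = \<zero>) =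
        (\<exists>z \<in> tuples (carrier R) (b' (Suc k)).
           \<forall>i<b' k. c i = lin_comb (ring_module R) (d (Suc k) i) z (b' (Suc k)))"
    proof (cases "k \<le> n")
      case True
      then show ?thesis using exact_Suc[of c "k - 1"] k c b'[of k] b'[of "Suc k"] b'[of "k - 1"] by simp
    next
      case False
      \<comment> \<open>Both sides hold trivially. For \<open>k\<close> equal to
        \<open>Suc n\<close> the target may have positive rank, but each of its coordinates is an
        empty sum.\<close>
      then have "b' k = 0" "b' (Suc k) = 0" by (auto simp: b'_def)
      then show ?thesis by (auto simp: tuples_def)
    qed
  qed
  then show ?thesis unfolding proj_dim_less_def by (intro exI[of _ b'] exI) (auto simp: b'_def)
qed

text \<open>If the rank were positive, the first basis vector would be a cycle, hence a boundary.
  Its coordinate 1 would then be a combination of entries of the next differential, which all lie in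
  the proper ideal \<open>m\<close>.\<close>

lemma proj_dim_less_if_differential_zero:
  assumes m: "ideal m R" "\<one> \<notin> m"
    and min: "\<And>i j. i < b (Suc n) \<Longrightarrow> j < b (Suc (Suc n)) \<Longrightarrow> d (Suc (Suc n)) i j \<in> m"
    and zero: "\<And>i j. i < b n \<Longrightarrow> j < b (Suc n) \<Longrightarrow> d (Suc n) i j = \<zero>"
  shows "proj_dim_less R M (Suc n)"
proof (rule proj_dim_less_if_rank_zero, rule ccontr)
  interpret m: ideal m R by fact
  assume "b (Suc n) \<noteq> 0"
  then have pos: "0 < b (Suc n)" by simp
  let ?c = "\<lambda>j::nat. if j = 0 then \<one> else \<zero>"
  have c: "?c \<in> tuples (carrier R) (b (Suc n))" by (auto intro: tuplesI)
  have "lin_comb (ring_module R) (d (Suc n) i) ?c (b (Suc n)) = \<zero>" if "i < b n" for i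
    using R.lin_comb_ring_unit_right[OF pos _ d_row[OF that], of \<one>] zero[OF that pos] by simp
  then obtain z where z: "z \<in> tuples (carrier R) (b (Suc (Suc n)))"
    "\<forall>i<b (Suc n). ?c i = lin_comb (ring_module R) (d (Suc (Suc n)) i) z (b (Suc (Suc n)))"
    using exact_Suc[OF c] by blast
  have "lin_comb (ring_module R) (d (Suc (Suc n)) 0) z (b (Suc (Suc n))) \<in> m"
    by (rule RM.lin_comb_in_submodule[OF m.submodule_ring_module[OF R.is_cring]])
      (use min[OF pos] z(1) d_row[OF pos] in \<open>auto simp: tuples_def intro: m.I_r_closed\<close>)
  then show False using z(2) pos m(2) by auto
qed

end

section \<open>The four conclusions, from annihilation, local splitting and truncation\<close>

theorem theorem4p12:
  fixes R :: "'a ring" and m :: "'a set" and J :: "'a set"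
    and M :: "('a, 'm) module" and XM :: "('a, 'x) module" and N :: "'x set"
    and t :: nat and b :: "nat \<Rightarrow> nat" and d :: "nat \<Rightarrow> nat \<Rightarrow> nat \<Rightarrow> 'a" and g :: "nat \<Rightarrow> 'm"
  assumes R: "noeth_local_ring R m"
    and M: "module R M" "finitely_generated R M"
    and XM: "module R XM" "finitely_generated R XM"
    and J: "ideal J R"
    and N: "submodule N R XM"
    and N_sub: "N \<subseteq> ideal_smult R XM (ideal_prod_set R m J) (carrier XM)"
    and fin_len: "quotient_finite_length R XM (colon_sub R XM N J)"
    and colon_eq: "colon_sub R XM N J
                     = colon_sub R XM (ideal_smult R XM m N) (ideal_prod_set R m J)"
    and t: "t \<ge> 1"
    and res: "minimal_free_resolution R m M b d g"
    and tor: "tor_vanishes XM N b d t"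
  shows
    "(\<forall>i<b (t - 1). \<forall>j<b t. \<forall>y \<in> ideal_smult R XM J (carrier XM).
        d t i j \<odot>\<^bsub>XM\<^esub> y = \<zero>\<^bsub>XM\<^esub>)
   \<and> ((faithful R XM \<and> (\<exists>a \<in> J. non_zero_divisor R a)) \<longrightarrow> proj_dim_less R M t)
   \<and> (((\<forall>p. primeideal p R \<longrightarrow> in_support R XM (ideal_smult R XM J (carrier XM)) p)
        \<and> (\<forall>p \<in> ass_ring R. locally_free_at R M p)) \<longrightarrow> proj_dim_less R M t)
   \<and> (tor_vanishes XM {\<zero>\<^bsub>XM\<^esub>} b d t \<longrightarrow>
        (\<forall>a \<in> J. \<forall>y \<in> tuples (carrier XM) (b t). \<exists>z \<in> tuples (carrier XM) (b (Suc t)).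
           \<forall>i<b t. a \<odot>\<^bsub>XM\<^esub> y i = mat_app XM (d (Suc t)) (b (Suc t)) z i))"
proof -
  \<comment> \<open>Writing t as a successor makes the differential in question run from rank
    \<open>b t\<close> to rank \<open>b n\<close>, without truncated subtraction.\<close>
  obtain n where n: "t = Suc n" using t by (cases t) auto
  have min: "d (Suc k) i j \<in> m" if "i < b k" "j < b (Suc k)" for k i j
    using res that unfolding minimal_free_resolution_def by (metis diff_Suc_1 le_add1 plus_1_eq_Suc)
  interpret F: resolved_module R M b d g
    using M(1) res
    by (simp add: resolved_module_def lmodule_def resolved_module_axioms_def minimal_free_resolution_def)
  interpret X: lmodule R XM using XM(1) by (simp add: lmodule_def)
  interpret J: ideal J R by (rule J)
  interpret E: exact_mod_submodule R XM "d t" "d (Suc t)" "b n" "b t" "b (Suc t)" N m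
  proof (rule exact_mod_submodule.intro[OF X.lmodule_axioms], rule exact_mod_submodule_axioms.intro)
    fix y assume "y \<in> tuples (carrier XM) (b t)" "\<And>i. i < b n \<Longrightarrow> lin_comb XM (d t i) y (b t) \<in> N"
    then show "\<exists>z \<in> tuples (carrier XM) (b (Suc t)).
        \<forall>j<b t. y j \<ominus>\<^bsub>XM\<^esub> lin_comb XM (d (Suc t) j) z (b (Suc t)) \<in> N"
      using tor n unfolding tor_vanishes_def mat_app_eq by simp
  qed (use R N min F.d_closed F.comp_Suc in \<open>simp_all add: n\<close>)
  have JX: "ideal_smult R XM J (carrier XM) = span_over XM J (carrier XM)"
    by (rule X.ideal_smult_eq_span_over[OF J.a_subset subset_refl])
  have ann: "d t i j \<odot>\<^bsub>XM\<^esub> y = \<zero>\<^bsub>XM\<^esub>"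
    if "i < b n" "j < b t" "y \<in> ideal_smult R XM J (carrier XM)" for i j y
    by (rule E.entries_annihilate[OF XM(2) J N_sub E.entries_into_colon[OF J fin_len colon_eq] that])
  have dR: "d t i j \<in> carrier R" if "i < b n" "j < b t" for i j
    using F.d_closed that n by auto
  have mem: "a \<odot>\<^bsub>XM\<^esub> x \<in> ideal_smult R XM J (carrier XM)" if "a \<in> J" "x \<in> carrier XM" for a x
    unfolding JX by (rule X.smult_in_span_over[OF that J.a_subset subset_refl])
  have pd: "proj_dim_less R M t" if "\<And>i j. i < b n \<Longrightarrow> j < b t \<Longrightarrow> d t i j = \<zero>\<^bsub>R\<^esub>"
    unfolding n using that n min E.m.I_notcarr E.m.one_imp_carrier
    by (intro F.proj_dim_less_if_differential_zero[OF E.m.ideal_axioms]) auto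
  show ?thesis
  proof (intro conjI impI)
    show "\<forall>i<b (t - 1). \<forall>j<b t. \<forall>y \<in> ideal_smult R XM J (carrier XM). d t i j \<odot>\<^bsub>XM\<^esub> y = \<zero>\<^bsub>XM\<^esub>"
      using ann n by simp
  next
    assume "faithful R XM \<and> (\<exists>a \<in> J. non_zero_divisor R a)"
    then obtain a where faith: "faithful R XM" and a: "a \<in> J" "non_zero_divisor R a" by blast
    show "proj_dim_less R M t"
    proof (rule pd)
      fix i j assume ij: "i < b n" "j < b t"
      have aR: "a \<in> carrier R" using a J.a_subset by auto
      \<comment> \<open>As aX lies in JX, the entry kills aX; faithfulness turns this into a
        vanishing product in the ring, from which the non-zero-divisor \<open>a\<close> is
        cancelled.\<close>
      have "(a \<otimes>\<^bsub>R\<^esub> d t i j) \<odot>\<^bsub>XM\<^esub> x = \<zero>\<^bsub>XM\<^esub>" if "x \<in> carrier XM" for x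
        using ann[OF ij mem[OF a(1) that]] that aR dR[OF ij]
        by (simp add: X.smult_assoc1 X.smult_left_comm)
      then have "a \<otimes>\<^bsub>R\<^esub> d t i j = \<zero>\<^bsub>R\<^esub>"
        using faith aR dR[OF ij] unfolding faithful_def by simp
      then show "d t i j = \<zero>\<^bsub>R\<^esub>" using a(2) dR[OF ij] unfolding non_zero_divisor_def by blast
    qed
  next
    assume *: "(\<forall>p. primeideal p R \<longrightarrow> in_support R XM (ideal_smult R XM J (carrier XM)) p)
        \<and> (\<forall>p \<in> ass_ring R. locally_free_at R M p)"
    show "proj_dim_less R M t"
    proof (rule pd)
      fix i j assume ij: "i < b n" "j < b t"
      show "d t i j = \<zero>\<^bsub>R\<^esub>"
      proof (rule cring.zero_if_zero_at_ass[OF _ _ dR[OF ij]])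
        show "cring R" "noetherian_ring R" using R by (simp_all add: noeth_local_ring_def)
        fix p assume "p \<in> ass_ring R"
        then have p: "primeideal p R" and free: "locally_free_at R M p"
          using * by (auto simp: ass_ring_def)
        obtain y where y: "y \<in> ideal_smult R XM J (carrier XM)"
          "\<forall>s \<in> carrier R - p. s \<odot>\<^bsub>XM\<^esub> y \<noteq> \<zero>\<^bsub>XM\<^esub>"
          using * p unfolding in_support_def by blast
        \<comment> \<open>An entry outside \<open>p\<close> would be an admissible denominator
          killing \<open>y\<close>, against the choice of \<open>y\<close> as a witness for the
          support.\<close>
        have "d t i j \<in> p" if "i < b n" "j < b t" for i j
          using ann[OF that y(1)] dR[OF that] y(2) by blast
        then show "\<exists>s \<in> carrier R - p. s \<otimes>\<^bsub>R\<^esub> d t i j = \<zero>\<^bsub>R\<^esub>"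
          using F.locally_zero[OF p free, of n i j] ij n by simp
      qed
    qed
  next
    \<comment> \<open>The syzygy Im d_t is the cokernel of d_(t+1) by exactness. By right exactness
      of the tensor product, \<open>a\<close> kills its tensor product with X exactly when
      \<open>a\<close> times every vector is in the image of d_(t+1) on X. Such a vector is a cycle
      by the first conclusion, so the vanishing Tor makes it a boundary.\<close>
    assume tor0: "tor_vanishes XM {\<zero>\<^bsub>XM\<^esub>} b d t"
    show "\<forall>a \<in> J. \<forall>y \<in> tuples (carrier XM) (b t). \<exists>z \<in> tuples (carrier XM) (b (Suc t)).
           \<forall>i<b t. a \<odot>\<^bsub>XM\<^esub> y i = mat_app XM (d (Suc t)) (b (Suc t)) z i"
    proof (intro ballI)
      fix a y assume a: "a \<in> J" and y: "y \<in> tuples (carrier XM) (b t)"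
      have aR: "a \<in> carrier R" using a J.a_subset by auto
      have ay: "(\<lambda>i. a \<odot>\<^bsub>XM\<^esub> y i) \<in> tuples (carrier XM) (b t)"
        using y aR by (auto simp: tuples_def)
      have "lin_comb XM (d t i) (\<lambda>i. a \<odot>\<^bsub>XM\<^esub> y i) (b t) = \<zero>\<^bsub>XM\<^esub>" if "i < b n" for i
      proof -
        \<comment> \<open>The zero submodule is used as target, so that the vanishing of the terms
          gives the vanishing of the sum.\<close>
        have "lin_comb XM (d t i) (\<lambda>i. a \<odot>\<^bsub>XM\<^esub> y i) (b t) \<in> {\<zero>\<^bsub>XM\<^esub>}"
          using ann[OF that _ mem[OF a tuplesD[OF y]]] E.A_tuples[OF that] ay
          by (intro X.lin_comb_in_submodule X.submoduleI) auto
        then show ?thesis by simp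
      qed
      then obtain z where z: "z \<in> tuples (carrier XM) (b (Suc t))"
        "\<forall>i<b t. a \<odot>\<^bsub>XM\<^esub> y i \<ominus>\<^bsub>XM\<^esub> mat_app XM (d (Suc t)) (b (Suc t)) z i \<in> {\<zero>\<^bsub>XM\<^esub>}"
        using tor0[unfolded tor_vanishes_def, rule_format, OF ay] n by (auto simp: mat_app_eq)
      have "a \<odot>\<^bsub>XM\<^esub> y i = mat_app XM (d (Suc t)) (b (Suc t)) z i" if i: "i < b t" for i
        using z(2)[rule_format, OF i] tuplesD[OF ay i] X.lin_comb_closed[OF E.B_tuples[OF i] z(1)]
        by (simp add: mat_app_eq X.M.eq_if_minus_eq_zero)
      then show "\<exists>z \<in> tuples (carrier XM) (b (Suc t)).
          \<forall>i<b t. a \<odot>\<^bsub>XM\<^esub> y i = mat_app XM (d (Suc t)) (b (Suc t)) z i"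
        using z(1) by blast
    qed
  qed
qed

end
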